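(* Let $\mathbf{X}$ be a represented space. The following are equivalent: (1) $\mathbf{X}$ is discrete, i.e. $x\mapsto\{x\}:\mathbf{X}\to\mathcal{O}(\mathbf{X})$ is well-defined and continuous. (2) $\operatorname{id}:\mathcal{V}(\mathbf{X})\to\mathcal{O}(\mathbf{X})$ is well-defined and continuous. (3) $\cap:\mathcal{V}(\mathbf{X})\times\mathcal{V}(\mathbf{X})\to\mathcal{V}(\mathbf{X})$ is well-defined and continuous, and $\mathbf{X}$ is $T_1$. (4) The map $=:\mathbf{X}\times\mathbf{X}\to\mathbb{S}$ with $=(x,x)=\top$ and $=(x,y)=\bot$ for $x\neq y$ is continuous. (5) $\Delta_{\mathbf{X}}=\{(x,x)\mid x\in X\}\in\mathcal{O}(\mathbf{X}\times\mathbf{X})$. Likewise, the following are equivalent: $\mathbf{X}$ is computably discrete (the map in (1) is computable); (2), (3), (4) with "continuous" replaced by "computable"; and $\Delta_{\mathbf{X}}$ is a computable element of $\mathcal{O}(\mathbf{X}\times\mathbf{X})$.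
   Context: A represented space $\mathbf{X}=(X,\delta_X)$ is a set $X$ with a partial surjection $\delta_X:\subseteq\{0,1\}^{\mathbb{N}}\to X$. A map $f:\subseteq\mathbf{X}\to\mathbf{Y}$ is realized by $F:\subseteq\{0,1\}^{\mathbb{N}}\to\{0,1\}^{\mathbb{N}}$ if $\delta_Y(F(p))=f(\delta_X(p))$ for all $p\in\operatorname{dom}(f\circ\delta_X)$; $f$ is computable (continuous) if it has a computable (continuous) realizer; an element is computable if it has a computable name. Products use a standard pairing of names. $\mathcal{C}(\mathbf{X},\mathbf{Y})$ is the represented space of continuous maps, $0^n1p$ naming $f$ iff the $n$-th oracle Turing machine with oracle $p$ computes a realizer of $f$. $\mathbb{S}=\{\top,\bot\}$ is represented by $\delta_{\mathbb{S}}(0^{\mathbb{N}})=\bot$, $\delta_{\mathbb{S}}(p)=\top$ otherwise. $\mathcal{O}(\mathbf{X})$: $U$ is named by any $\mathcal{C}(\mathbf{X},\mathbb{S})$-name of $x\mapsto(\top$ iff $x\in U)$. The topology of $\mathbf{X}$ is the quotient topology induced by $\delta_X$ (open sets = elements of $\mathcal{O}(\mathbf{X})$); $T_1$ and closures $\overline{A}$ refer to it. For $A\subseteq X$ let $O_A=\{U\in\mathcal{O}(\mathbf{X})\mid U\cap A\neq\emptyset\}$ (note $O_A=O_B$ iff $\overline{A}=\overline{B}$). $\mathcal{V}(\mathbf{X})$ (overt sets) is the represented space whose elements are the closures $\overline{A}$ of those $A\subseteq X$ with $O_A\in\mathcal{O}(\mathcal{O}(\mathbf{X}))$, $\overline{A}$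 being named by any $\mathcal{O}(\mathcal{O}(\mathbf{X}))$-name of $O_A$.
   Formalization: Condition (2), in both the continuous and the computable list, is stated with the added requirement that X is T0, since without it the two-point indiscrete represented space satisfies (2) but is not discrete. *)

theory Defs
  imports "HOL-Analysis.Analysis" "HOL-Library.Nat_Bijection"
begin

text \<open>
  Sequences in \<open>{0,1}\<^sup>\<nat>\<close> carry the product topology of the discrete space \<open>bool\<close>, which is the
  library's topology on \<open>nat \<Rightarrow> bool\<close>. Partial functions on them are option-valued.
\<close>

type_synonym cantor = "nat \<Rightarrow> bool"

definition zero_seq :: cantor where
  "zero_seq = (\<lambda>_. False)"

definition pair_fst :: "cantor \<Rightarrow> cantor" where
  "pair_fst r = (\<lambda>k. r (2 * k))"

definition pair_snd :: "cantor \<Rightarrow> cantor" where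
  "pair_snd r = (\<lambda>k. r (2 * k + 1))"

text \<open>The sequence \<open>0\<^sup>n1p\<close>.\<close>

definition index_prefix :: "nat \<Rightarrow> cantor \<Rightarrow> cantor" where
  "index_prefix n p = (\<lambda>k. if k < n then False else if k = n then True else p (k - Suc n))"

section \<open>Oracle Turing machines\<close>

text \<open>
  A machine has a read-only oracle tape, a read-only input tape, a write-only one-way output tape and
  work tapes. Its finite control is given, as usual for Type-2 machines, as a flowchart of
  elementary tape operations: a list of instructions, where control passes to the next list
  entry unless a jump is taken. A program mentions only finitely many work tapes and symbols, so
  each machine has a finite number of tapes and a finite alphabet. Symbol \<open>0\<close> is the blank; on the
  oracle and input tapes the bits are read as symbols \<open>0\<close> and \<open>1\<close>. Tapes are infinite to the right;
  a left move from the first cell has no effect.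
\<close>

datatype tape = Oracle | Input | Work nat

datatype instr =
    MoveLeft tape
  | MoveRight tape
  | Write nat nat          \<comment> \<open>work tape, symbol\<close>
  | JumpIf tape nat nat    \<comment> \<open>if this symbol is scanned on this tape, go to this position\<close>
  | Output bool

type_synonym otm = "instr list"

record config =
  cf_pos :: nat
  cf_head :: "tape \<Rightarrow> nat"
  cf_cells :: "nat \<Rightarrow> nat \<Rightarrow> nat"
  cf_out :: "bool list"

definition init_config :: config where
  "init_config = \<lparr>cf_pos = 0, cf_head = (\<lambda>_. 0), cf_cells = (\<lambda>_ _. 0), cf_out = []\<rparr>"

fun scanned :: "cantor \<Rightarrow> cantor \<Rightarrow> config \<Rightarrow> tape \<Rightarrow> nat" where
  "scanned p q c Oracle = of_bool (p (cf_head c Oracle))"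
| "scanned p q c Input = of_bool (q (cf_head c Input))"
| "scanned p q c (Work w) = cf_cells c w (cf_head c (Work w))"

fun exec_instr :: "cantor \<Rightarrow> cantor \<Rightarrow> instr \<Rightarrow> config \<Rightarrow> config" where
  "exec_instr p q (MoveLeft t) c =
     c\<lparr>cf_pos := Suc (cf_pos c), cf_head := (cf_head c)(t := cf_head c t - 1)\<rparr>"
| "exec_instr p q (MoveRight t) c =
     c\<lparr>cf_pos := Suc (cf_pos c), cf_head := (cf_head c)(t := Suc (cf_head c t))\<rparr>"
| "exec_instr p q (Write w s) c =
     c\<lparr>cf_pos := Suc (cf_pos c),
       cf_cells := (cf_cells c)(w := (cf_cells c w)(cf_head c (Work w) := s))\<rparr>"
| "exec_instr p q (JumpIf t s l) c =
     c\<lparr>cf_pos := (if scanned p q c t = s then l else Suc (cf_pos c))\<rparr>"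
| "exec_instr p q (Output b) c =
     c\<lparr>cf_pos := Suc (cf_pos c), cf_out := cf_out c @ [b]\<rparr>"

text \<open>Leaving the list of instructions means halting.\<close>

definition otm_step :: "otm \<Rightarrow> cantor \<Rightarrow> cantor \<Rightarrow> config \<Rightarrow> config" where
  "otm_step M p q c =
     (if cf_pos c < length M then exec_instr p q (M ! cf_pos c) c else c)"

definition otm_config :: "otm \<Rightarrow> cantor \<Rightarrow> cantor \<Rightarrow> nat \<Rightarrow> config" where
  "otm_config M p q t = (otm_step M p q ^^ t) init_config"

text \<open>
  The partial function on sequences computed by a machine with oracle \<open>p\<close>; it is undefined on the
  inputs for which only finitely many output bits are ever written.
\<close>

definition otm_fun :: "otm \<Rightarrow> cantor \<Rightarrow> cantor \<Rightarrow> cantor option" where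
  "otm_fun M p q =
     (if \<forall>k. \<exists>t. k < length (cf_out (otm_config M p q t))
      then Some (\<lambda>k. cf_out (otm_config M p q (LEAST t. k < length (cf_out (otm_config M p q t)))) ! k)
      else None)"

fun decode_tape :: "nat \<Rightarrow> tape" where
  "decode_tape 0 = Oracle"
| "decode_tape (Suc 0) = Input"
| "decode_tape (Suc (Suc w)) = Work w"

definition decode_instr :: "nat \<Rightarrow> instr" where
  "decode_instr m =
     (let (k, a) = prod_decode m; (b, c) = prod_decode a; (d, e) = prod_decode c in
      if k = 0 then MoveLeft (decode_tape a)
      else if k = 1 then MoveRight (decode_tape a)
      else if k = 2 then Write b c
      else if k = 3 then JumpIf (decode_tape b) d e
      else Output (odd a))"

definition nth_otm :: "nat \<Rightarrow> otm" where
  "nth_otm n = map decode_instr (list_decode n)"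

lemma surj_decode_tape: "\<exists>a. decode_tape a = t"
  by (cases t) (metis decode_tape.simps)+

lemma surj_decode_instr: "\<exists>m. decode_instr m = i"
proof (cases i)
  case (MoveLeft t)
  obtain a where "decode_tape a = t" using surj_decode_tape by blast
  then have "decode_instr (prod_encode (0, a)) = i"
    by (simp add: decode_instr_def MoveLeft split: prod.split)
  then show ?thesis ..
next
  case (MoveRight t)
  obtain a where "decode_tape a = t" using surj_decode_tape by blast
  then have "decode_instr (prod_encode (1, a)) = i"
    by (simp add: decode_instr_def MoveRight split: prod.split)
  then show ?thesis ..
next
  case (Write w s)
  then have "decode_instr (prod_encode (2, prod_encode (w, s))) = i"
    by (simp add: decode_instr_def split: prod.split)
  then show ?thesis ..
next
  case (JumpIf t s l)
  obtain a where "decode_tape a = t" using surj_decode_tape by blast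
  then have "decode_instr (prod_encode (3, prod_encode (a, prod_encode (s, l)))) = i"
    by (simp add: decode_instr_def JumpIf)
  then show ?thesis ..
next
  case (Output b)
  then have "decode_instr (prod_encode (4, of_bool b)) = i"
    by (simp add: decode_instr_def split: prod.split)
  then show ?thesis ..
qed

text \<open>Every machine occurs in the numbering.\<close>

lemma surj_nth_otm: "surj nth_otm"
proof (rule surjI)
  fix M :: otm
  have "decode_instr (SOME m. decode_instr m = i) = i" for i
    using surj_decode_instr by (rule someI_ex)
  then show "nth_otm (list_encode (map (\<lambda>i. SOME m. decode_instr m = i) M)) = M"
    by (simp add: nth_otm_def comp_def)
qed

text \<open>Computability without an oracle means that the oracle tape holds \<open>0\<^sup>\<nat>\<close>.\<close>

definition computable_fun :: "(cantor \<Rightarrow> cantor option) \<Rightarrow> bool" where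
  "computable_fun F \<longleftrightarrow> (\<exists>n. F = otm_fun (nth_otm n) zero_seq)"

definition continuous_fun :: "(cantor \<Rightarrow> cantor option) \<Rightarrow> bool" where
  "continuous_fun F \<longleftrightarrow> continuous_on (dom F) (\<lambda>p. the (F p))"

definition computable_seq :: "cantor \<Rightarrow> bool" where
  "computable_seq r \<longleftrightarrow> (\<exists>n. otm_fun (nth_otm n) zero_seq zero_seq = Some r)"

section \<open>Represented spaces\<close>

text \<open>
  A represented space is given by its representation alone; the underlying set is the range of the
  representation, since representations are surjective.
\<close>

type_synonym 'a rep_space = "cantor \<Rightarrow> 'a option"

definition points :: "'a rep_space \<Rightarrow> 'a set" where
  "points X = ran X"

definition realizes :: "'a rep_space \<Rightarrow> 'b rep_space \<Rightarrow> (cantor \<Rightarrow> cantor option) \<Rightarrow> ('a \<Rightarrow> 'b) \<Rightarrow> bool" where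
  "realizes X Y F f \<longleftrightarrow> (\<forall>p x. X p = Some x \<longrightarrow> (\<exists>q. F p = Some q \<and> Y q = Some (f x)))"

text \<open>
  Maps are given by total HOL functions that are only relevant on \<^term>\<open>points X\<close>. The first conjunct
  says that \<open>f\<close> is well-defined as a map from \<open>X\<close> to \<open>Y\<close>.
\<close>

definition rep_continuous :: "'a rep_space \<Rightarrow> 'b rep_space \<Rightarrow> ('a \<Rightarrow> 'b) \<Rightarrow> bool" where
  "rep_continuous X Y f \<longleftrightarrow>
     f \<in> points X \<rightarrow> points Y \<and> (\<exists>F. continuous_fun F \<and> realizes X Y F f)"

definition rep_computable :: "'a rep_space \<Rightarrow> 'b rep_space \<Rightarrow> ('a \<Rightarrow> 'b) \<Rightarrow> bool" where
  "rep_computable X Y f \<longleftrightarrow>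
     f \<in> points X \<rightarrow> points Y \<and> (\<exists>F. computable_fun F \<and> realizes X Y F f)"

definition computable_point :: "'a rep_space \<Rightarrow> 'a \<Rightarrow> bool" where
  "computable_point X x \<longleftrightarrow> (\<exists>p. computable_seq p \<and> X p = Some x)"

definition prod_space :: "'a rep_space \<Rightarrow> 'b rep_space \<Rightarrow> ('a \<times> 'b) rep_space" where
  "prod_space X Y r =
     (case (X (pair_fst r), Y (pair_snd r)) of (Some x, Some y) \<Rightarrow> Some (x, y) | _ \<Rightarrow> None)"

text \<open>The representation whose names of \<open>x\<close> are the \<open>p\<close> with \<open>N p x\<close>, for single-valued \<open>N\<close>.\<close>

definition represented_by :: "(cantor \<Rightarrow> 'a \<Rightarrow> bool) \<Rightarrow> 'a rep_space" where
  "represented_by N p = (if \<exists>!x. N p x then Some (THE x. N p x) else None)"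

text \<open>
  \<open>\<C>(X, Y)\<close>. Its elements are functions on \<^term>\<open>points X\<close>, normalised to be \<^const>\<open>undefined\<close> elsewhere.
\<close>

definition names_map :: "'a rep_space \<Rightarrow> 'b rep_space \<Rightarrow> cantor \<Rightarrow> ('a \<Rightarrow> 'b) \<Rightarrow> bool" where
  "names_map X Y r f \<longleftrightarrow> f \<in> points X \<rightarrow>\<^sub>E points Y \<and>
     (\<exists>n p. r = index_prefix n p \<and> realizes X Y (otm_fun (nth_otm n) p) f)"

definition map_space :: "'a rep_space \<Rightarrow> 'b rep_space \<Rightarrow> ('a \<Rightarrow> 'b) rep_space" where
  "map_space X Y = represented_by (names_map X Y)"

lemma index_prefix_inject:
  assumes "index_prefix n p = index_prefix m q"
  shows "n = m \<and> p = q"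
proof -
  have "\<not> n < m" using fun_cong[OF assms, of n] by (auto simp: index_prefix_def)
  moreover have "\<not> m < n" using fun_cong[OF assms, of m] by (auto simp: index_prefix_def)
  ultimately have "n = m" by simp
  moreover have "p k = q k" for k
    using fun_cong[OF assms, of "k + Suc n"] \<open>n = m\<close> by (simp add: index_prefix_def)
  ultimately show ?thesis by auto
qed

lemma names_map_unique:
  assumes "names_map X Y r f" "names_map X Y r g"
  shows "f = g"
proof (rule PiE_ext)
  show "f \<in> points X \<rightarrow>\<^sub>E points Y" "g \<in> points X \<rightarrow>\<^sub>E points Y"
    using assms by (auto simp: names_map_def)
  fix x assume "x \<in> points X"
  then obtain q where "X q = Some x" by (auto simp: points_def ran_def)
  with assms show "f x = g x"
    unfolding names_map_def realizes_def by (metis index_prefix_inject option.inject)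
qed

lemma map_space_eq_Some_iff: "map_space X Y r = Some f \<longleftrightarrow> names_map X Y r f"
  unfolding map_space_def represented_by_def
  by (smt (verit, best) names_map_unique option.distinct(1) option.inject the_equality)

text \<open>Sierpinski space, with \<^const>\<open>True\<close> as top element.\<close>

definition sierpinski :: "bool rep_space" where
  "sierpinski p = Some (p \<noteq> zero_seq)"

definition open_space :: "'a rep_space \<Rightarrow> 'a set rep_space" where
  "open_space X r = map_option (\<lambda>f. {x \<in> points X. f x}) (map_space X sierpinski r)"

text \<open>The quotient topology.\<close>

definition rep_topology :: "'a rep_space \<Rightarrow> 'a topology" where
  "rep_topology X = topology (\<lambda>U. U \<subseteq> points X \<and>
     openin (top_of_set (dom X)) {p \<in> dom X. the (X p) \<in> U})"

lemma openin_rep_topology: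
  "openin (rep_topology X) U \<longleftrightarrow>
     U \<subseteq> points X \<and> openin (top_of_set (dom X)) {p \<in> dom X. the (X p) \<in> U}"
proof -
  let ?P = "\<lambda>U. {p \<in> dom X. the (X p) \<in> U}"
  have "istopology (\<lambda>U. U \<subseteq> points X \<and> openin (top_of_set (dom X)) (?P U))"
    unfolding istopology_def
  proof (intro conjI allI impI; (elim conjE)?)
    fix S T
    assume "openin (top_of_set (dom X)) (?P S)" "openin (top_of_set (dom X)) (?P T)"
    moreover have "?P (S \<inter> T) = ?P S \<inter> ?P T" by auto
    ultimately show "openin (top_of_set (dom X)) (?P (S \<inter> T))" by auto
  next
    fix K
    assume "\<forall>U\<in>K. U \<subseteq> points X \<and> openin (top_of_set (dom X)) (?P U)"
    moreover have "?P (\<Union>K) = (\<Union>U\<in>K. ?P U)" by auto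
    ultimately show "openin (top_of_set (dom X)) (?P (\<Union>K))" by auto
  qed auto
  then show ?thesis
    unfolding rep_topology_def by (simp add: topology_inverse')
qed

lemma topspace_rep_topology: "topspace (rep_topology X) = points X"
proof -
  have "{p \<in> dom X. the (X p) \<in> points X} = dom X"
    by (auto simp: points_def ran_def)
  then have "openin (rep_topology X) (points X)"
    using openin_topspace[of "top_of_set (dom X)"] by (simp add: openin_rep_topology)
  then show ?thesis
    by (meson openin_rep_topology openin_subset openin_topspace subset_antisym)
qed

text \<open>The set \<open>O\<^sub>A\<close> and the space \<open>\<V>(X)\<close> of overt sets.\<close>

definition opens_meeting :: "'a rep_space \<Rightarrow> 'a set \<Rightarrow> 'a set set" where
  "opens_meeting X A = {U \<in> points (open_space X). U \<inter> A \<noteq> {}}"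

definition overt_space :: "'a rep_space \<Rightarrow> 'a set rep_space" where
  "overt_space X = represented_by (\<lambda>r C. \<exists>A \<subseteq> points X.
     C = rep_topology X closure_of A \<and>
     open_space (open_space X) r = Some (opens_meeting X A))"

text \<open>
  The identity from \<open>\<V>(X)\<close> to \<open>\<O>(X)\<close> can be continuous although \<open>X\<close> is not discrete: on the indiscrete
  space with two points both spaces have the elements \<open>{}\<close> and \<open>X\<close>. For \<open>T\<^sub>0\<close> spaces this does not
  happen, so the characterisation of discreteness by this map includes the \<open>T\<^sub>0\<close> axiom.
\<close>

definition diagonal :: "'a rep_space \<Rightarrow> ('a \<times> 'a) set" where
  "diagonal X = {(x, x) | x. x \<in> points X}"

definition rep_discrete :: "'a rep_space \<Rightarrow> bool" where
  "rep_discrete X \<longleftrightarrow> rep_continuous X (open_space X) (\<lambda>x. {x})"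

definition rep_computably_discrete :: "'a rep_space \<Rightarrow> bool" where
  "rep_computably_discrete X \<longleftrightarrow> rep_computable X (open_space X) (\<lambda>x. {x})"

end

theory Submission
  imports Defs
begin

text \<open>
  All conditions are compared with one: some machine with oracle \<open>p\<close> maps a name of \<open>(x, y)\<close> to a
  Sierpinski name of \<open>x = y\<close>; here \<open>p = 0\<^sup>\<nat>\<close> in the computable case and \<open>p\<close> is arbitrary in the
  continuous case. If it holds, realizers for the maps in (1), (2) and (3) are all of the shape
  \<open>q \<mapsto> 0\<^sup>m1\<langle>p, q\<rangle>\<close> for a suitable machine \<open>m\<close>. Conversely a realizer of one of these maps,
  applied to a name computed from \<open>(x, y)\<close>, returns the name of an open set which contains a point
  computed from \<open>(x, y)\<close> iff \<open>x = y\<close>. In the continuous case this makes the diagonal open, and every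
  open set is semidecided by a machine whose oracle lists the prefixes of names inside it.

  The indices in names are arbitrary, so a universal machine is needed. Only total machines have to
  be constructed, since a semidecision can print one bit for each stage of a search. Hence
  primitive recursive functionals suffice; stage \<open>t\<close> of a Turing machine computation is one of them.
\<close>

section \<open>Register programs on Turing machines\<close>

text \<open>A name returned by a realizer may have any index and any oracle, so nothing can be read
  off its form. The one question put to such a name \<open>w\<close> is \<open>accepts w q\<close>:
  does the machine coded in \<open>w\<close> ever print a \<open>1\<close> on input
  \<open>q\<close>? This predicate makes sense for all sequences, is semidecidable in both arguments
  and depends on a finite part of each, so the computable and the continuous case can be treated
  alike. A realizer is partial and may be undefined off the names. In the computable case acceptance
  is therefore searched along the finite outputs of its machine; in the continuous case continuity
  on the domain carries acceptance over to nearby names. The inputs fed to realizers of (2) and (3)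
  name closures of points. In (3) the T1 axiom makes these closures singletons. In (2) the realizer
  shows them to be open, which makes the specialization preorder symmetric; T0 then reduces it to
  equality.\<close>

definition reaches :: "otm \<Rightarrow> cantor \<Rightarrow> cantor \<Rightarrow> config \<Rightarrow> config \<Rightarrow> bool" where
  "reaches M p q c c' \<longleftrightarrow> (\<exists>t. (otm_step M p q ^^ t) c = c')"

lemma reaches_refl: "reaches M p q c c"
  unfolding reaches_def by (rule exI[of _ 0]) simp

lemma reaches_trans: "reaches M p q c c' \<Longrightarrow> reaches M p q c' c'' \<Longrightarrow> reaches M p q c c''"
  unfolding reaches_def by (metis comp_apply funpow_add)

lemma reaches_step:
  assumes "cf_pos c < length M" "reaches M p q (exec_instr p q (M ! cf_pos c) c) c'"
  shows "reaches M p q c c'"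
proof -
  have "reaches M p q c (exec_instr p q (M ! cf_pos c) c)"
    unfolding reaches_def using assms(1) by (intro exI[of _ 1]) (simp add: otm_step_def)
  then show ?thesis using assms(2) reaches_trans by blast
qed

definition segment :: "otm \<Rightarrow> nat \<Rightarrow> instr list \<Rightarrow> bool" where
  "segment M b xs \<longleftrightarrow> (\<forall>i<length xs. b + i < length M \<and> M ! (b + i) = xs ! i)"

lemma segment_Nil [simp]: "segment M b []"
  by (simp add: segment_def)

lemma segment_Cons [simp]:
  "segment M b (x # xs) \<longleftrightarrow> b < length M \<and> M ! b = x \<and> segment M (Suc b) xs"
  by (auto simp: segment_def nth_Cons less_Suc_eq_0_disj split: nat.split)

lemma segment_append [simp]:
  "segment M b (xs @ ys) \<longleftrightarrow> segment M b xs \<and> segment M (b + length xs) ys"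
  by (induction xs arbitrary: b) auto

text \<open>
  Work tapes serve as registers: the value is the head position, and a \<open>1\<close> in the first cell
  allows testing for zero.
\<close>

definition markers :: "nat \<Rightarrow> config \<Rightarrow> bool" where
  "markers W c \<longleftrightarrow> (\<forall>w<W. cf_cells c w = (\<lambda>i. of_bool (i = 0)))"

type_synonym transform = "cantor \<Rightarrow> cantor \<Rightarrow> (tape \<Rightarrow> nat) \<Rightarrow> (tape \<Rightarrow> nat)"

text \<open>Jump targets are absolute, so code is a function of the address at which it starts; its
  length is fixed so that later addresses can be computed. Cells and output stay unchanged, and only
  head positions have to be tracked.\<close>

definition implements :: "nat \<Rightarrow> (nat \<Rightarrow> instr list) \<Rightarrow> nat \<Rightarrow> transform \<Rightarrow> bool" where
  "implements W code n T \<longleftrightarrow> (\<forall>b. length (code b) = n) \<and>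
     (\<forall>M p q c. segment M (cf_pos c) (code (cf_pos c)) \<longrightarrow> markers W c \<longrightarrow>
        reaches M p q c (c\<lparr>cf_pos := cf_pos c + n, cf_head := T p q (cf_head c)\<rparr>))"

definition realizable :: "transform \<Rightarrow> bool" where
  "realizable T \<longleftrightarrow> (\<exists>W code n. implements W code n T)"

lemma markers_mono: "markers W c \<Longrightarrow> V \<le> W \<Longrightarrow> markers V c"
  by (auto simp: markers_def)

lemma markers_update [simp]:
  "markers W (c\<lparr>cf_pos := l\<rparr>) = markers W c" "markers W (c\<lparr>cf_head := h\<rparr>) = markers W c"
  "markers W (c\<lparr>cf_out := bs\<rparr>) = markers W c"
  by (auto simp: markers_def)

lemma implements_mono: "implements W code n T \<Longrightarrow> W \<le> V \<Longrightarrow> implements V code n T"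
  unfolding implements_def using markers_mono by blast

text \<open>Continuation form: the rest of the run is a premise, which lets the runs of consecutive
  blocks be chained.\<close>

lemma implementsD:
  assumes "implements W code n T" "segment M b (code b)" "cf_pos c = b" "markers W c"
    and "reaches M p q (c\<lparr>cf_pos := b + n, cf_head := T p q (cf_head c)\<rparr>) c'"
  shows "reaches M p q c c'"
  using assms reaches_trans unfolding implements_def by blast

section \<open>Control flow for register programs\<close>

lemma realizable_id: "realizable (\<lambda>_ _ \<sigma>. \<sigma>)"
  unfolding realizable_def implements_def
  by (intro exI[of _ 0] exI[of _ "\<lambda>_. []"]) (auto intro: reaches_refl)

lemma realizable_cong:
  assumes "realizable S" "\<And>p q \<sigma> t. S p q \<sigma> t = T p q \<sigma> t"
  shows "realizable T"
proof -
  have "S = T" using assms(2) by (intro ext)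
  then show ?thesis using assms(1) by simp
qed

lemma realizable_right: "realizable (\<lambda>_ _ \<sigma>. \<sigma>(t := Suc (\<sigma> t)))"
  unfolding realizable_def implements_def
  by (intro exI[of _ 0] exI[of _ "\<lambda>_. [MoveRight t]"] exI[of _ 1] conjI allI impI, simp)
    (rule reaches_step, auto intro: reaches_refl)

lemma realizable_left: "realizable (\<lambda>_ _ \<sigma>. \<sigma>(t := \<sigma> t - 1))"
  unfolding realizable_def implements_def
  by (intro exI[of _ 0] exI[of _ "\<lambda>_. [MoveLeft t]"] exI[of _ 1] conjI allI impI, simp)
    (rule reaches_step, auto intro: reaches_refl)

lemma realizable_seq:
  assumes "realizable S" "realizable T"
  shows "realizable (\<lambda>p q \<sigma>. T p q (S p q \<sigma>))"
proof -
  obtain V c1 m where 1: "implements V c1 m S" using assms by (auto simp: realizable_def)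
  obtain W c2 n where 2: "implements W c2 n T" using assms by (auto simp: realizable_def)
  let ?X = "max V W"
  have 1: "implements ?X c1 m S" and 2: "implements ?X c2 n T"
    using 1 2 by (auto intro: implements_mono)
  have "implements ?X (\<lambda>b. c1 b @ c2 (b + m)) (m + n) (\<lambda>p q \<sigma>. T p q (S p q \<sigma>))"
    unfolding implements_def
  proof (intro conjI allI impI)
    fix b show "length (c1 b @ c2 (b + m)) = m + n" using 1 2 by (simp add: implements_def)
  next
    fix M p q c
    assume seg: "segment M (cf_pos c) (c1 (cf_pos c) @ c2 (cf_pos c + m))" and mk: "markers ?X c"
    have "length (c1 (cf_pos c)) = m" using 1 by (simp add: implements_def)
    with seg have seg: "segment M (cf_pos c) (c1 (cf_pos c))"
        "segment M (cf_pos c + m) (c2 (cf_pos c + m))" by auto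
    show "reaches M p q c (c\<lparr>cf_pos := cf_pos c + (m + n),
        cf_head := T p q (S p q (cf_head c))\<rparr>)"
      apply (rule implementsD[OF 1 seg(1) refl mk])
      apply (rule implementsD[OF 2 seg(2)])
      using mk by (auto simp: add.assoc intro: reaches_refl)
  qed
  then show ?thesis by (auto simp: realizable_def)
qed

definition test :: "cantor \<Rightarrow> cantor \<Rightarrow> (tape \<Rightarrow> nat) \<Rightarrow> tape \<Rightarrow> bool" where
  "test p q \<sigma> t = (case t of Oracle \<Rightarrow> p (\<sigma> Oracle) | Input \<Rightarrow> q (\<sigma> Input) | Work w \<Rightarrow> \<sigma> (Work w) \<noteq> 0)"

text \<open>The symbol that signals a failed test: a scanned marker \<open>1\<close> means that a
  register is zero, a scanned \<open>0\<close> that a bit is false.\<close>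

definition test_symbol :: "tape \<Rightarrow> nat" where
  "test_symbol t = (case t of Work w \<Rightarrow> 1 | _ \<Rightarrow> 0)"

definition test_bound :: "tape \<Rightarrow> nat" where
  "test_bound t = (case t of Work w \<Rightarrow> Suc w | _ \<Rightarrow> 0)"

lemma scanned_test:
  "markers (test_bound t) c \<Longrightarrow> scanned p q c t = test_symbol t \<longleftrightarrow> \<not> test p q (cf_head c) t"
  by (cases t) (auto simp: test_def test_symbol_def test_bound_def markers_def)

lemma realizable_if:
  assumes "realizable T"
  shows "realizable (\<lambda>p q \<sigma>. if test p q \<sigma> t then T p q \<sigma> else \<sigma>)"
proof -
  obtain W code n where 0: "implements W code n T" using assms by (auto simp: realizable_def)
  let ?V = "max (test_bound t) W"
  have 1: "implements ?V code n T" using 0 by (auto intro: implements_mono)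
  have len: "length (code b) = n" for b using 1 by (simp add: implements_def)
  have "implements ?V (\<lambda>b. JumpIf t (test_symbol t) (b + Suc n) # code (Suc b)) (Suc n)
      (\<lambda>p q \<sigma>. if test p q \<sigma> t then T p q \<sigma> else \<sigma>)"
    unfolding implements_def
  proof (intro conjI allI impI)
    fix M p q c
    assume seg: "segment M (cf_pos c) (JumpIf t (test_symbol t) (cf_pos c + Suc n) # code (Suc (cf_pos c)))"
      and mk: "markers ?V c"
    have sc: "scanned p q c t = test_symbol t \<longleftrightarrow> \<not> test p q (cf_head c) t"
      using mk by (intro scanned_test) (auto elim: markers_mono)
    show "reaches M p q c (c\<lparr>cf_pos := cf_pos c + Suc n,
        cf_head := if test p q (cf_head c) t then T p q (cf_head c) else cf_head c\<rparr>)"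
    proof (cases "test p q (cf_head c) t")
      case True
      have "reaches M p q (c\<lparr>cf_pos := Suc (cf_pos c)\<rparr>)
          (c\<lparr>cf_pos := cf_pos c + Suc n, cf_head := T p q (cf_head c)\<rparr>)"
        apply (rule implementsD[OF 1, of _ "Suc (cf_pos c)"])
        using seg mk by (auto intro: reaches_refl)
      then show ?thesis
        apply - apply (rule reaches_step[of c])
        using seg sc True by auto
    next
      case False
      then show ?thesis
        apply - apply (rule reaches_step[of c])
        using seg sc by (auto intro: reaches_refl)
    qed
  qed (simp add: len)
  then show ?thesis by (auto simp: realizable_def)
qed

text \<open>The counter is lowered before each round and \<open>keep\<close> protects it from the
  body, so its initial value is the number of rounds.\<close>

lemma realizable_loop:
  assumes "realizable T" and keep: "\<And>p q \<sigma>. T p q \<sigma> (Work r) = \<sigma> (Work r)"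
  shows "realizable (\<lambda>p q \<sigma>. ((\<lambda>\<sigma>. T p q (\<sigma>(Work r := \<sigma> (Work r) - 1))) ^^ \<sigma> (Work r)) \<sigma>)"
proof -
  obtain W code n where 0: "implements W code n T" using assms by (auto simp: realizable_def)
  let ?V = "max (Suc r) W"
  have 1: "implements ?V code n T" using 0 by (auto intro: implements_mono)
  have len: "length (code b) = n" for b using 1 by (simp add: implements_def)
  \<comment> \<open>The four extra instructions are the test, the decrement and two jumps back. The
    jumps cover both values of the scanned oracle bit and so act as an unconditional one.\<close>
  let ?code = "\<lambda>b. [JumpIf (Work r) 1 (b + (n + 4)), MoveLeft (Work r)] @ code (b + 2) @
    [JumpIf Oracle 0 b, JumpIf Oracle 1 b]"
  have "implements ?V ?code (n + 4)
      (\<lambda>p q \<sigma>. ((\<lambda>\<sigma>. T p q (\<sigma>(Work r := \<sigma> (Work r) - 1))) ^^ \<sigma> (Work r)) \<sigma>)"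
    unfolding implements_def
  proof (intro conjI allI impI)
    fix M p q c
    assume "segment M (cf_pos c) (?code (cf_pos c))" "markers ?V c"
    then show "reaches M p q c (c\<lparr>cf_pos := cf_pos c + (n + 4),
        cf_head := ((\<lambda>\<sigma>. T p q (\<sigma>(Work r := \<sigma> (Work r) - 1))) ^^ cf_head c (Work r)) (cf_head c)\<rparr>)"
    proof (induction "cf_head c (Work r)" arbitrary: c)
      case 0
      have "scanned p q c (Work r) = 1"
        using 0 by (simp add: markers_def)
      then show ?case
        apply - apply (rule reaches_step)
        using 0 by (auto intro!: reaches_refl)
    next
      case (Suc k)
      let ?b = "cf_pos c"
      have seg: "?b < length M" "M ! ?b = JumpIf (Work r) 1 (?b + (n + 4))"
        "Suc ?b < length M" "M ! Suc ?b = MoveLeft (Work r)" "segment M (Suc (Suc ?b)) (code (Suc (Suc ?b)))"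
        "?b + n + 2 < length M" "M ! (?b + n + 2) = JumpIf Oracle 0 ?b"
        "?b + n + 3 < length M" "M ! (?b + n + 3) = JumpIf Oracle 1 ?b"
        using Suc.prems(1) by (auto simp: len eval_nat_numeral)
      have sc: "scanned p q c (Work r) = 0"
        using Suc.prems(2) Suc.hyps(2) by (simp add: markers_def)
      let ?h = "T p q ((cf_head c)(Work r := k))"
      let ?c = "c\<lparr>cf_head := ?h\<rparr>"
      have k: "k = cf_head ?c (Work r)" using keep by simp
      have ih: "reaches M p q ?c (c\<lparr>cf_pos := ?b + (n + 4),
        cf_head := ((\<lambda>\<sigma>. T p q (\<sigma>(Work r := \<sigma> (Work r) - 1))) ^^ k) ?h\<rparr>)"
        using Suc.hyps(1)[OF k] Suc.prems k by simp
      have eq: "((\<lambda>\<sigma>. T p q (\<sigma>(Work r := \<sigma> (Work r) - 1))) ^^ cf_head c (Work r)) (cf_head c)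
         = ((\<lambda>\<sigma>. T p q (\<sigma>(Work r := \<sigma> (Work r) - 1))) ^^ k) ?h"
        by (simp add: Suc.hyps(2)[symmetric] funpow_Suc_right del: funpow.simps)
      let ?d = "c\<lparr>cf_pos := ?b + n + 2, cf_head := ?h\<rparr>"
      have c: "?d\<lparr>cf_pos := ?b\<rparr> = ?c" by simp
      have return: "reaches M p q ?d ?c"
      proof (cases "p (?h Oracle)")
        case False
        then show ?thesis
          apply - apply (rule reaches_step[of ?d])
          using seg c by (auto intro!: reaches_refl)
      next
        case True
        have "reaches M p q (?d\<lparr>cf_pos := ?b + n + 3\<rparr>) ?c"
          apply - apply (rule reaches_step[of "?d\<lparr>cf_pos := ?b + n + 3\<rparr>"])
          using seg True by (auto intro!: reaches_refl)
        then show ?thesis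
          apply - apply (rule reaches_step[of ?d])
          using seg True by (auto simp: eval_nat_numeral)
      qed
      have "reaches M p q (c\<lparr>cf_pos := Suc (Suc ?b), cf_head := (cf_head c)(Work r := k)\<rparr>) ?d"
        apply (rule implementsD[OF 1 seg(5)])
        using Suc.prems(2) by (auto simp: intro: reaches_refl)
      then have "reaches M p q (c\<lparr>cf_pos := Suc ?b\<rparr>) ?d"
        apply - apply (rule reaches_step[of "c\<lparr>cf_pos := Suc ?b\<rparr>"])
        using seg Suc.hyps(2)[symmetric] by auto
      then have "reaches M p q c ?d"
        apply - apply (rule reaches_step[of c])
        using seg sc by auto
      then show ?case
        unfolding eq using return ih reaches_trans by blast
    qed
  qed (simp add: len)
  then show ?thesis by (auto simp: realizable_def)
qed

section \<open>Register arithmetic and the pairing function\<close>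

lemma realizable_clear: "realizable (\<lambda>_ _ \<sigma>. \<sigma>(Work r := 0))"
proof -
  have "((\<lambda>\<sigma>. \<sigma>(Work r := \<sigma> (Work r) - 1)) ^^ n) \<sigma> = \<sigma>(Work r := \<sigma> (Work r) - n)" for n \<sigma>
    by (induction n) (auto simp: fun_eq_iff)
  then show ?thesis
    using realizable_loop[OF realizable_id, of r] by simp
qed

text \<open>The source register is consumed. With \<open>t\<close> the oracle or input tape this
  moves a read head by a computed distance.\<close>

lemma realizable_loop_shift:
  "t \<noteq> Work r \<Longrightarrow> realizable (\<lambda>_ _ \<sigma>. \<sigma>(Work r := 0, t := \<sigma> t + \<sigma> (Work r)))"
  "t \<noteq> Work r \<Longrightarrow> realizable (\<lambda>_ _ \<sigma>. \<sigma>(Work r := 0, t := \<sigma> t - \<sigma> (Work r)))"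
proof -
  assume t: "t \<noteq> Work r"
  have "((\<lambda>\<sigma>. (\<sigma>(Work r := \<sigma> (Work r) - 1))(t := Suc ((\<sigma>(Work r := \<sigma> (Work r) - 1)) t))) ^^ n) \<sigma>
      = \<sigma>(Work r := \<sigma> (Work r) - n, t := \<sigma> t + n)" for n \<sigma>
    using t by (induction n) (auto simp: fun_eq_iff)
  then show "realizable (\<lambda>_ _ \<sigma>. \<sigma>(Work r := 0, t := \<sigma> t + \<sigma> (Work r)))"
    using realizable_loop[OF realizable_right, of t r] t by simp
  have "((\<lambda>\<sigma>. (\<sigma>(Work r := \<sigma> (Work r) - 1))(t := (\<sigma>(Work r := \<sigma> (Work r) - 1)) t - 1)) ^^ n) \<sigma>
      = \<sigma>(Work r := \<sigma> (Work r) - n, t := \<sigma> t - n)" for n \<sigma>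
    using t by (induction n) (auto simp: fun_eq_iff)
  then show "realizable (\<lambda>_ _ \<sigma>. \<sigma>(Work r := 0, t := \<sigma> t - \<sigma> (Work r)))"
    using realizable_loop[OF realizable_left, of t r] t by simp
qed

text \<open>Counting \<open>r\<close> down destroys it, so each round also counts \<open>s\<close>
  up, and \<open>s\<close> is finally emptied back into \<open>r\<close>.\<close>

lemma realizable_add:
  assumes "r \<noteq> u" "r \<noteq> s" "u \<noteq> s"
  shows "realizable (\<lambda>_ _ \<sigma>. \<sigma>(Work u := \<sigma> (Work u) + \<sigma> (Work r), Work s := 0))"
proof -
  let ?F = "\<lambda>\<sigma>. \<sigma>(Work r := \<sigma> (Work r) - 1, Work u := Suc (\<sigma> (Work u)), Work s := Suc (\<sigma> (Work s)))"
  have "(?F ^^ n) \<sigma> = \<sigma>(Work r := \<sigma> (Work r) - n, Work u := \<sigma> (Work u) + n, Work s := \<sigma> (Work s) + n)"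
    for n \<sigma> using assms by (induction n) (auto simp: fun_eq_iff)
  then have "realizable (\<lambda>_ _ \<sigma>. \<sigma>(Work r := 0, Work u := \<sigma> (Work u) + \<sigma> (Work r),
      Work s := \<sigma> (Work s) + \<sigma> (Work r)))"
    using realizable_loop[OF realizable_seq[OF realizable_right[of "Work u"] realizable_right[of "Work s"]], of r] assms
    by simp
  from realizable_seq[OF realizable_seq[OF realizable_clear[of s] this] realizable_loop_shift(1)[of "Work r" s]]
  show ?thesis
    by (rule realizable_cong) (use assms in \<open>auto\<close>)
qed

lemma realizable_copy:
  assumes "r \<noteq> u" "r \<noteq> s" "u \<noteq> s"
  shows "realizable (\<lambda>_ _ \<sigma>. \<sigma>(Work u := \<sigma> (Work r), Work s := 0))"
  using realizable_seq[OF realizable_clear[of u] realizable_add[OF assms]] assms by simp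

text \<open>Random access: one copy of the address moves the head to the bit, a second copy moves it
  back after the test. Truncated subtraction is exact here.\<close>

lemma realizable_read:
  assumes t: "\<And>w. t \<noteq> Work w" and dist: "distinct [i, u, a, s]"
  shows "realizable (\<lambda>p q \<sigma>. \<sigma>(Work u := of_bool (test p q (\<sigma>(t := \<sigma> t + \<sigma> (Work i))) t),
    Work a := 0, Work s := 0))"
proof -
  have ne: "i \<noteq> a" "i \<noteq> s" "a \<noteq> s" "u \<noteq> a" "u \<noteq> s" "i \<noteq> u" using dist by auto
  note copy = realizable_copy[OF ne(1,2,3)]
  show ?thesis
    using realizable_seq[OF realizable_seq[OF realizable_seq[OF realizable_seq[OF realizable_seq[OF
      copy realizable_loop_shift(1)[OF t, of a]] realizable_clear[of u]]
      realizable_if[OF realizable_right[of "Work u"], of t]] copy] realizable_loop_shift(2)[OF t, of a]]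
    by (rule realizable_cong)
      (use t ne in \<open>cases t; auto simp: test_def\<close>)
qed

lemma realizable_triangle:
  assumes "distinct [s, u, a, d]"
  shows "realizable (\<lambda>_ _ \<sigma>. \<sigma>(Work s := 0, Work u := \<sigma> (Work u) + triangle (\<sigma> (Work s)),
     Work a := 0, Work d := 0))"
proof -
  \<comment> \<open>The counter is lowered before the body runs, so a round entered with counter
    \<open>n + 1\<close> adds \<open>n + 1\<close>; the rounds add up to
    \<open>triangle\<close>.\<close>
  let ?body = "\<lambda>\<sigma>. \<sigma>(Work u := Suc (\<sigma> (Work u) + \<sigma> (Work s)), Work d := 0)"
  let ?F = "\<lambda>\<sigma>. ?body (\<sigma>(Work s := \<sigma> (Work s) - 1))"
  have r: "realizable (\<lambda>_ _. ?body)"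
    using realizable_seq[OF realizable_add[of s u d] realizable_right[of "Work u"]] assms
    by (auto simp: fun_upd_twist)
  have "(?F ^^ n) \<sigma> = \<sigma>(Work s := 0, Work u := \<sigma> (Work u) + triangle n,
     Work d := if n = 0 then \<sigma> (Work d) else 0)" if "\<sigma> (Work s) = n" for n \<sigma>
    using that
  proof (induction n arbitrary: \<sigma>)
    case 0
    then show ?case by (auto simp: fun_eq_iff)
  next
    case (Suc n)
    show ?case
      unfolding funpow_Suc_right comp_apply
      by (subst Suc.IH) (use Suc.prems assms in \<open>auto simp: fun_eq_iff\<close>)
  qed
  then have "((?F ^^ \<sigma> (Work s)) \<sigma>) = \<sigma>(Work s := 0, Work u := \<sigma> (Work u) + triangle (\<sigma> (Work s)),
     Work d := if \<sigma> (Work s) = 0 then \<sigma> (Work d) else 0)" for \<sigma> by blast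
  moreover have "realizable (\<lambda>_ _ \<sigma>. (?F ^^ \<sigma> (Work s)) \<sigma>)"
    by (rule realizable_loop[OF r]) (use assms in auto)
  ultimately have "realizable (\<lambda>_ _ \<sigma>. \<sigma>(Work s := 0, Work u := \<sigma> (Work u) + triangle (\<sigma> (Work s)),
     Work d := if \<sigma> (Work s) = 0 then \<sigma> (Work d) else 0))" by simp
  from realizable_seq[OF realizable_seq[OF this realizable_clear[of d]] realizable_clear[of a]]
  show ?thesis
    by (rule realizable_cong) (use assms in \<open>auto\<close>)
qed

lemma realizable_prod_encode:
  assumes "distinct [x, y, u, s, a, d]"
  shows "realizable (\<lambda>_ _ \<sigma>. \<sigma>(Work u := prod_encode (\<sigma> (Work x), \<sigma> (Work y)),
     Work s := 0, Work a := 0, Work d := 0))"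
proof -
  have 1: "realizable (\<lambda>_ _ \<sigma>. \<sigma>(Work u := \<sigma> (Work x), Work a := 0))"
    and 2: "realizable (\<lambda>_ _ \<sigma>. \<sigma>(Work s := \<sigma> (Work x), Work a := 0))"
    and 3: "realizable (\<lambda>_ _ \<sigma>. \<sigma>(Work s := \<sigma> (Work s) + \<sigma> (Work y), Work a := 0))"
    using assms by (auto intro!: realizable_copy realizable_add)
  have 4: "realizable (\<lambda>_ _ \<sigma>. \<sigma>(Work s := 0, Work u := \<sigma> (Work u) + triangle (\<sigma> (Work s)),
      Work a := 0, Work d := 0))"
    using assms by (intro realizable_triangle) auto
  show ?thesis
    by (rule realizable_cong[OF realizable_seq[OF realizable_seq[OF realizable_seq[OF 1 2] 3] 4]])
      (use assms in \<open>auto simp: prod_encode_def\<close>)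
qed

text \<open>Successor in the enumeration of pairs along antidiagonals. Decoding becomes counting
  from the pair coded by \<open>0\<close>, without inverting \<open>triangle\<close>.\<close>

definition next_pair :: "nat \<times> nat \<Rightarrow> nat \<times> nat" where
  "next_pair z = (if snd z = 0 then (0, Suc (fst z)) else (Suc (fst z), snd z - 1))"

lemma prod_encode_next_pair: "prod_encode (next_pair z) = Suc (prod_encode z)"
  by (cases z; cases "snd z") (auto simp: next_pair_def prod_encode_def)

lemma prod_decode_funpow: "prod_decode n = (next_pair ^^ n) (0, 0)"
proof -
  have "prod_encode ((next_pair ^^ n) (0, 0)) = n"
    by (induction n) (auto simp: prod_encode_next_pair, simp add: prod_encode_def)
  then show ?thesis by (metis prod_encode_inverse)
qed

lemma realizable_prod_decode:
  assumes "distinct [n, x, y, f]"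
  shows "realizable (\<lambda>_ _ \<sigma>. \<sigma>(Work n := 0, Work x := fst (prod_decode (\<sigma> (Work n))),
     Work y := snd (prod_decode (\<sigma> (Work n))), Work f := 0))"
proof -
  let ?xy = "\<lambda>\<sigma>. next_pair (\<sigma> (Work x), \<sigma> (Work y))"
  let ?body = "\<lambda>\<sigma>. \<sigma>(Work x := fst (?xy \<sigma>), Work y := snd (?xy \<sigma>), Work f := 0)"
  let ?F = "\<lambda>\<sigma>. ?body (\<sigma>(Work n := \<sigma> (Work n) - 1))"
  \<comment> \<open>The flag \<open>f\<close> records whether \<open>y\<close> was zero at the start
    of the round: branch \<open>A\<close> may itself lower \<open>y\<close> to zero, so branch
    \<open>B\<close> cannot be guarded by \<open>y\<close>.\<close>
  have set: "realizable (\<lambda>_ _ \<sigma>. \<sigma>(Work f := 1))"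
    using realizable_seq[OF realizable_clear[of f] realizable_right[of "Work f"]] by simp
  have A: "realizable (\<lambda>_ _ \<sigma>. \<sigma>(Work f := 0, Work x := \<sigma> (Work x) + 1, Work y := \<sigma> (Work y) - 1))"
    using realizable_seq[OF realizable_seq[OF realizable_clear[of f] realizable_right[of "Work x"]] realizable_left[of "Work y"]] assms
    by simp
  have B: "realizable (\<lambda>_ _ \<sigma>. \<sigma>(Work f := 0, Work x := 0, Work y := Suc (\<sigma> (Work y) + \<sigma> (Work x))))"
    using realizable_seq[OF realizable_seq[OF realizable_clear[of f] realizable_loop_shift(1)[of "Work y" x]] realizable_right[of "Work y"]] assms
    by simp
  have r: "realizable (\<lambda>_ _. ?body)"
    using realizable_seq[OF realizable_seq[OF set realizable_if[OF A, of "Work y"]] realizable_if[OF B, of "Work f"]]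
    by (rule realizable_cong)
      (use assms in \<open>auto simp: test_def next_pair_def\<close>)
  have "(?F ^^ k) \<sigma> = \<sigma>(Work n := 0, Work x := fst ((next_pair ^^ k) (\<sigma> (Work x), \<sigma> (Work y))),
     Work y := snd ((next_pair ^^ k) (\<sigma> (Work x), \<sigma> (Work y))), Work f := if k = 0 then \<sigma> (Work f) else 0)"
    if "\<sigma> (Work n) = k" for k \<sigma>
    using that
  proof (induction k arbitrary: \<sigma>)
    case 0
    then show ?case by (auto simp: fun_eq_iff)
  next
    case (Suc n)
    show ?case
      unfolding funpow_Suc_right comp_apply
      by (subst Suc.IH) (use Suc.prems assms in \<open>auto simp: fun_eq_iff\<close>)
  qed
  then have eq: "(?F ^^ \<sigma> (Work n)) \<sigma> = \<sigma>(Work n := 0,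
     Work x := fst ((next_pair ^^ \<sigma> (Work n)) (\<sigma> (Work x), \<sigma> (Work y))),
     Work y := snd ((next_pair ^^ \<sigma> (Work n)) (\<sigma> (Work x), \<sigma> (Work y))),
     Work f := if \<sigma> (Work n) = 0 then \<sigma> (Work f) else 0)" for \<sigma> by blast
  have "realizable (\<lambda>_ _ \<sigma>. (?F ^^ \<sigma> (Work n)) \<sigma>)"
    by (rule realizable_loop[OF r]) (use assms in auto)
  from realizable_seq[OF realizable_seq[OF realizable_seq[OF realizable_clear[of x] realizable_clear[of y]] realizable_clear[of f]] this[unfolded eq]]
  show ?thesis
    by (rule realizable_cong)
      (use assms in \<open>auto simp: prod_decode_funpow\<close>)
qed

section \<open>Recursive functionals\<close>

definition frame :: "nat \<Rightarrow> nat \<Rightarrow> (tape \<Rightarrow> nat) \<Rightarrow> (tape \<Rightarrow> nat) \<Rightarrow> bool" where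
  "frame b u \<sigma> \<sigma>' \<longleftrightarrow> \<sigma>' Oracle = \<sigma> Oracle \<and> \<sigma>' Input = \<sigma> Input \<and>
     (\<forall>w<b. w \<noteq> u \<longrightarrow> \<sigma>' (Work w) = \<sigma> (Work w))"

text \<open>Reading addresses cells relative to the current head, hence the value is claimed only
  for read heads at cell 0. As \<open>frame\<close> restores both heads, this condition persists
  through composed programs.\<close>

definition register_program ::
    "nat \<Rightarrow> nat \<Rightarrow> nat \<Rightarrow> (cantor \<Rightarrow> cantor \<Rightarrow> nat \<Rightarrow> nat) \<Rightarrow> transform \<Rightarrow> bool" where
  "register_program i u b f T \<longleftrightarrow> realizable T \<and>
     (\<forall>p q \<sigma>. frame b u \<sigma> (T p q \<sigma>) \<and>
       (\<sigma> Oracle = 0 \<longrightarrow> \<sigma> Input = 0 \<longrightarrow> T p q \<sigma> (Work u) = f p q (\<sigma> (Work i))))"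

text \<open>
  Total functionals computed by a program with registers from \<open>b\<close> on as scratch space, for any
  choice of \<open>b\<close> and of the input and output register below \<open>b\<close>.
\<close>

definition recursive :: "(cantor \<Rightarrow> cantor \<Rightarrow> nat \<Rightarrow> nat) \<Rightarrow> bool" where
  "recursive f \<longleftrightarrow> (\<forall>i u b. i < b \<longrightarrow> u < b \<longrightarrow> i \<noteq> u \<longrightarrow> (\<exists>T. register_program i u b f T))"

lemma recursiveI:
  assumes "\<And>i u b. i < b \<Longrightarrow> u < b \<Longrightarrow> i \<noteq> u \<Longrightarrow> \<exists>T. register_program i u b f T"
  shows "recursive f"
  using assms by (auto simp: recursive_def)

lemma recursive_program:
  assumes "recursive f" "i < b" "u < b" "i \<noteq> u"
  obtains T where "realizable T" "\<And>p q \<sigma>. T p q \<sigma> Oracle = \<sigma> Oracle"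
    "\<And>p q \<sigma>. T p q \<sigma> Input = \<sigma> Input"
    "\<And>p q \<sigma> w. w < b \<Longrightarrow> w \<noteq> u \<Longrightarrow> T p q \<sigma> (Work w) = \<sigma> (Work w)"
    "\<And>p q \<sigma>. \<sigma> Oracle = 0 \<Longrightarrow> \<sigma> Input = 0 \<Longrightarrow> T p q \<sigma> (Work u) = f p q (\<sigma> (Work i))"
  using assms unfolding recursive_def register_program_def frame_def by metis

lemma recursive_id: "recursive (\<lambda>p q x. x)"
proof (rule recursiveI)
  fix i u b :: nat assume "i < b" "u < b" "i \<noteq> u"
  then show "\<exists>T. register_program i u b (\<lambda>p q x. x) T"
    unfolding register_program_def frame_def
    by (intro exI[of _ "\<lambda>_ _ \<sigma>. \<sigma>(Work u := \<sigma> (Work i), Work b := 0)"] conjI realizable_copy) auto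
qed

lemma recursive_zero: "recursive (\<lambda>p q x. 0)"
proof (rule recursiveI)
  fix i u b :: nat assume "i < b" "u < b" "i \<noteq> u"
  then show "\<exists>T. register_program i u b (\<lambda>p q x. 0) T"
    unfolding register_program_def frame_def
    by (intro exI[of _ "\<lambda>_ _ \<sigma>. \<sigma>(Work u := 0)"] conjI realizable_clear) auto
qed

lemma recursive_Suc:
  assumes "recursive f"
  shows "recursive (\<lambda>p q x. Suc (f p q x))"
proof (rule recursiveI)
  fix i u b :: nat assume b: "i < b" "u < b" "i \<noteq> u"
  obtain T where T: "realizable T" "\<And>p q \<sigma>. T p q \<sigma> Oracle = \<sigma> Oracle"
    "\<And>p q \<sigma>. T p q \<sigma> Input = \<sigma> Input"
    "\<And>p q \<sigma> w. w < b \<Longrightarrow> w \<noteq> u \<Longrightarrow> T p q \<sigma> (Work w) = \<sigma> (Work w)"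
    "\<And>p q \<sigma>. \<sigma> Oracle = 0 \<Longrightarrow> \<sigma> Input = 0 \<Longrightarrow> T p q \<sigma> (Work u) = f p q (\<sigma> (Work i))"
    using recursive_program[OF assms b] by blast
  show "\<exists>T. register_program i u b (\<lambda>p q x. Suc (f p q x)) T"
    unfolding register_program_def frame_def
    by (rule exI, rule conjI, rule realizable_seq[OF T(1) realizable_right[of "Work u"]])
      (use b T in auto)
qed

text \<open>The intermediate value sits in register \<open>b\<close>, and both programs get their
  scratch space from \<open>Suc b\<close> on. This is why \<open>recursive\<close> quantifies over
  the bound.\<close>

lemma recursive_comp:
  assumes "recursive f" "recursive g"
  shows "recursive (\<lambda>p q x. f p q (g p q x))"
proof (rule recursiveI)
  fix i u b :: nat assume b: "i < b" "u < b" "i \<noteq> u"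
  then have b': "i < Suc b" "u < Suc b" "b < Suc b" "i \<noteq> b" "b \<noteq> u" by auto
  obtain S where S: "realizable S" "\<And>p q \<sigma>. S p q \<sigma> Oracle = \<sigma> Oracle"
    "\<And>p q \<sigma>. S p q \<sigma> Input = \<sigma> Input"
    "\<And>p q \<sigma> w. w < Suc b \<Longrightarrow> w \<noteq> b \<Longrightarrow> S p q \<sigma> (Work w) = \<sigma> (Work w)"
    "\<And>p q \<sigma>. \<sigma> Oracle = 0 \<Longrightarrow> \<sigma> Input = 0 \<Longrightarrow> S p q \<sigma> (Work b) = g p q (\<sigma> (Work i))"
    using recursive_program[OF assms(2) b'(1,3,4)] by blast
  obtain T where T: "realizable T" "\<And>p q \<sigma>. T p q \<sigma> Oracle = \<sigma> Oracle"
    "\<And>p q \<sigma>. T p q \<sigma> Input = \<sigma> Input"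
    "\<And>p q \<sigma> w. w < Suc b \<Longrightarrow> w \<noteq> u \<Longrightarrow> T p q \<sigma> (Work w) = \<sigma> (Work w)"
    "\<And>p q \<sigma>. \<sigma> Oracle = 0 \<Longrightarrow> \<sigma> Input = 0 \<Longrightarrow> T p q \<sigma> (Work u) = f p q (\<sigma> (Work b))"
    using recursive_program[OF assms(1) b'(3,2,5)] by blast
  show "\<exists>T. register_program i u b (\<lambda>p q x. f p q (g p q x)) T"
    unfolding register_program_def frame_def
    by (rule exI, rule conjI, rule realizable_seq[OF S(1) T(1)]) (use b S T in auto)
qed

lemma recursive_pair:
  assumes "recursive f" "recursive g"
  shows "recursive (\<lambda>p q x. prod_encode (f p q x, g p q x))"
proof (rule recursiveI)
  fix i u b :: nat assume b: "i < b" "u < b" "i \<noteq> u"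
  define c where "c = Suc (Suc b)"
  have b': "i < c" "b < c" "Suc b < c" "i \<noteq> b" "i \<noteq> Suc b" "u < b" using b by (auto simp: c_def)
  obtain S where S: "realizable S" "\<And>p q \<sigma>. S p q \<sigma> Oracle = \<sigma> Oracle"
    "\<And>p q \<sigma>. S p q \<sigma> Input = \<sigma> Input"
    "\<And>p q \<sigma> w. w < c \<Longrightarrow> w \<noteq> b \<Longrightarrow> S p q \<sigma> (Work w) = \<sigma> (Work w)"
    "\<And>p q \<sigma>. \<sigma> Oracle = 0 \<Longrightarrow> \<sigma> Input = 0 \<Longrightarrow> S p q \<sigma> (Work b) = f p q (\<sigma> (Work i))"
    using recursive_program[OF assms(1) b'(1,2,4)] by blast
  obtain T where T: "realizable T" "\<And>p q \<sigma>. T p q \<sigma> Oracle = \<sigma> Oracle"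
    "\<And>p q \<sigma>. T p q \<sigma> Input = \<sigma> Input"
    "\<And>p q \<sigma> w. w < c \<Longrightarrow> w \<noteq> Suc b \<Longrightarrow> T p q \<sigma> (Work w) = \<sigma> (Work w)"
    "\<And>p q \<sigma>. \<sigma> Oracle = 0 \<Longrightarrow> \<sigma> Input = 0 \<Longrightarrow> T p q \<sigma> (Work (Suc b)) = g p q (\<sigma> (Work i))"
    using recursive_program[OF assms(2) b'(1,3,5)] by blast
  have "distinct [b, Suc b, u, c, Suc c, Suc (Suc c)]" using b by (auto simp: c_def)
  note E = realizable_prod_encode[OF this]
  show "\<exists>T. register_program i u b (\<lambda>p q x. prod_encode (f p q x, g p q x)) T"
    unfolding register_program_def frame_def
    by (rule exI, rule conjI, rule realizable_seq[OF realizable_seq[OF S(1) T(1)] E])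
      (use b b' S(2-) T(2-) in auto)
qed

lemma recursive_unpair:
  assumes "recursive f"
  shows "recursive (\<lambda>p q x. fst (prod_decode (f p q x)))"
    and "recursive (\<lambda>p q x. snd (prod_decode (f p q x)))"
proof -
  have "\<exists>T. register_program i u b (\<lambda>p q x. fst (prod_decode (f p q x))) T"
    "\<exists>T. register_program i u b (\<lambda>p q x. snd (prod_decode (f p q x))) T"
    if b: "i < b" "u < b" "i \<noteq> u" for i u b
  proof -
    have b': "i < Suc b" "b < Suc b" "i \<noteq> b" using b by auto
    obtain T where T: "realizable T" "\<And>p q \<sigma>. T p q \<sigma> Oracle = \<sigma> Oracle"
      "\<And>p q \<sigma>. T p q \<sigma> Input = \<sigma> Input"
      "\<And>p q \<sigma> w. w < Suc b \<Longrightarrow> w \<noteq> b \<Longrightarrow> T p q \<sigma> (Work w) = \<sigma> (Work w)"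
      "\<And>p q \<sigma>. \<sigma> Oracle = 0 \<Longrightarrow> \<sigma> Input = 0 \<Longrightarrow> T p q \<sigma> (Work b) = f p q (\<sigma> (Work i))"
      using recursive_program[OF assms(1) b'] by blast
    have d1: "distinct [b, u, Suc b, Suc (Suc b)]" and d2: "distinct [b, Suc b, u, Suc (Suc b)]"
      using b by auto
    show "\<exists>T. register_program i u b (\<lambda>p q x. fst (prod_decode (f p q x))) T"
      unfolding register_program_def frame_def
      by (rule exI, rule conjI, rule realizable_seq[OF T(1) realizable_prod_decode[OF d1]])
        (use b T(2-) in auto)
    show "\<exists>T. register_program i u b (\<lambda>p q x. snd (prod_decode (f p q x))) T"
      unfolding register_program_def frame_def
      by (rule exI, rule conjI, rule realizable_seq[OF T(1) realizable_prod_decode[OF d2]])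
        (use b T(2-) in auto)
  qed
  then show "recursive (\<lambda>p q x. fst (prod_decode (f p q x)))"
    and "recursive (\<lambda>p q x. snd (prod_decode (f p q x)))"
    by (auto intro: recursiveI)
qed

lemma recursive_read:
  assumes "recursive f"
  shows "recursive (\<lambda>p q x. of_bool (p (f p q x)))" and "recursive (\<lambda>p q x. of_bool (q (f p q x)))"
proof -
  have "\<exists>T. register_program i u b (\<lambda>p q x. of_bool (p (f p q x))) T"
    "\<exists>T. register_program i u b (\<lambda>p q x. of_bool (q (f p q x))) T"
    if b: "i < b" "u < b" "i \<noteq> u" for i u b
  proof -
    have b': "i < Suc b" "b < Suc b" "i \<noteq> b" using b by auto
    obtain T where T: "realizable T" "\<And>p q \<sigma>. T p q \<sigma> Oracle = \<sigma> Oracle"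
      "\<And>p q \<sigma>. T p q \<sigma> Input = \<sigma> Input"
      "\<And>p q \<sigma> w. w < Suc b \<Longrightarrow> w \<noteq> b \<Longrightarrow> T p q \<sigma> (Work w) = \<sigma> (Work w)"
      "\<And>p q \<sigma>. \<sigma> Oracle = 0 \<Longrightarrow> \<sigma> Input = 0 \<Longrightarrow> T p q \<sigma> (Work b) = f p q (\<sigma> (Work i))"
      using recursive_program[OF assms(1) b'] by blast
    have d: "distinct [b, u, Suc b, Suc (Suc b)]" using b by auto
    show "\<exists>T. register_program i u b (\<lambda>p q x. of_bool (p (f p q x))) T"
      unfolding register_program_def frame_def
      by (rule exI, rule conjI, rule realizable_seq[OF T(1) realizable_read[of Oracle, OF _ d]], simp)
        (use b T(2-) in \<open>auto simp: test_def\<close>)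
    show "\<exists>T. register_program i u b (\<lambda>p q x. of_bool (q (f p q x))) T"
      unfolding register_program_def frame_def
      by (rule exI, rule conjI, rule realizable_seq[OF T(1) realizable_read[of Input, OF _ d]], simp)
        (use b T(2-) in \<open>auto simp: test_def\<close>)
  qed
  then show "recursive (\<lambda>p q x. of_bool (p (f p q x)))" and "recursive (\<lambda>p q x. of_bool (q (f p q x)))"
    by (auto intro: recursiveI)
qed

text \<open>Registers \<open>b\<close>, \<open>b + 1\<close>, \<open>b + 2\<close> hold the counter,
  the state and the next state. Input and output registers of a program differ, so each round ends
  by copying the next state back.\<close>

lemma recursive_funpow_aux:
  assumes "recursive f" "recursive g" "recursive h"
  shows "recursive (\<lambda>p q x. (f p q ^^ g p q x) (h p q x))"
proof (rule recursiveI)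
  fix i u b :: nat assume b: "i < b" "u < b" "i \<noteq> u"
  define c where "c = b + 3"
  have b': "i < c" "b < c" "Suc b < c" "Suc (Suc b) < c" "i \<noteq> b" "i \<noteq> Suc b" "Suc b \<noteq> Suc (Suc b)"
    using b by (auto simp: c_def)
  obtain S where S: "realizable S" "\<And>p q \<sigma>. S p q \<sigma> Oracle = \<sigma> Oracle"
    "\<And>p q \<sigma>. S p q \<sigma> Input = \<sigma> Input"
    "\<And>p q \<sigma> w. w < c \<Longrightarrow> w \<noteq> b \<Longrightarrow> S p q \<sigma> (Work w) = \<sigma> (Work w)"
    "\<And>p q \<sigma>. \<sigma> Oracle = 0 \<Longrightarrow> \<sigma> Input = 0 \<Longrightarrow> S p q \<sigma> (Work b) = g p q (\<sigma> (Work i))"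
    using recursive_program[OF assms(2) b'(1,2,5)] by blast
  obtain T where T: "realizable T" "\<And>p q \<sigma>. T p q \<sigma> Oracle = \<sigma> Oracle"
    "\<And>p q \<sigma>. T p q \<sigma> Input = \<sigma> Input"
    "\<And>p q \<sigma> w. w < c \<Longrightarrow> w \<noteq> Suc b \<Longrightarrow> T p q \<sigma> (Work w) = \<sigma> (Work w)"
    "\<And>p q \<sigma>. \<sigma> Oracle = 0 \<Longrightarrow> \<sigma> Input = 0 \<Longrightarrow> T p q \<sigma> (Work (Suc b)) = h p q (\<sigma> (Work i))"
    using recursive_program[OF assms(3) b'(1,3,6)] by blast
  obtain R where R: "realizable R" "\<And>p q \<sigma>. R p q \<sigma> Oracle = \<sigma> Oracle"
    "\<And>p q \<sigma>. R p q \<sigma> Input = \<sigma> Input"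
    "\<And>p q \<sigma> w. w < c \<Longrightarrow> w \<noteq> Suc (Suc b) \<Longrightarrow> R p q \<sigma> (Work w) = \<sigma> (Work w)"
    "\<And>p q \<sigma>. \<sigma> Oracle = 0 \<Longrightarrow> \<sigma> Input = 0 \<Longrightarrow> R p q \<sigma> (Work (Suc (Suc b))) = f p q (\<sigma> (Work (Suc b)))"
    using recursive_program[OF assms(1) b'(3,4,7)] by blast
  have C1: "realizable (\<lambda>_ _ \<sigma>. \<sigma>(Work (Suc b) := \<sigma> (Work (Suc (Suc b))), Work c := 0))"
    and C2: "realizable (\<lambda>_ _ \<sigma>. \<sigma>(Work u := \<sigma> (Work (Suc b)), Work c := 0))"
    using b by (auto intro!: realizable_copy simp: c_def)
  define B :: transform where
    "B = (\<lambda>p q \<sigma>. (\<lambda>\<sigma>. \<sigma>(Work (Suc b) := \<sigma> (Work (Suc (Suc b))), Work c := 0)) (R p q \<sigma>))"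
  have B: "realizable B" unfolding B_def using realizable_seq[OF R(1) C1] by simp
  define F where "F = (\<lambda>p q \<sigma>. B p q (\<sigma>(Work b := \<sigma> (Work b) - 1)))"
  have L: "realizable (\<lambda>p q \<sigma>. (F p q ^^ \<sigma> (Work b)) \<sigma>)"
    unfolding F_def by (rule realizable_loop[OF B]) (auto simp: B_def R(4) c_def)
  have F: "((F p q ^^ n) \<sigma>) Oracle = \<sigma> Oracle" "((F p q ^^ n) \<sigma>) Input = \<sigma> Input"
    "w < b \<Longrightarrow> (F p q ^^ n) \<sigma> (Work w) = \<sigma> (Work w)"
    "\<sigma> Oracle = 0 \<Longrightarrow> \<sigma> Input = 0 \<Longrightarrow> (F p q ^^ n) \<sigma> (Work (Suc b)) = (f p q ^^ n) (\<sigma> (Work (Suc b)))"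
    for p q n \<sigma> w
    by (induction n) (auto simp: F_def B_def R c_def)
  show "\<exists>T. register_program i u b (\<lambda>p q x. (f p q ^^ g p q x) (h p q x)) T"
    unfolding register_program_def frame_def
    by (rule exI, rule conjI, rule realizable_seq[OF realizable_seq[OF realizable_seq[OF S(1) T(1)] L] C2])
      (use b b' S(2-) T(2-) in \<open>auto simp: F\<close>)
qed

section \<open>Compiling recursive functionals to machines\<close>

lemma cf_out_exec_instr: "\<exists>bs. cf_out (exec_instr p q i c) = cf_out c @ bs"
  by (cases i) auto

lemma cf_out_mono:
  assumes "t \<le> t'"
  shows "\<exists>bs. cf_out (otm_config M p q t') = cf_out (otm_config M p q t) @ bs"
  using assms
proof (induction t' rule: dec_induct)
  case (step n)
  then show ?case
    using cf_out_exec_instr[of p q "M ! cf_pos (otm_config M p q n)" "otm_config M p q n"]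
    by (fastforce simp: otm_config_def otm_step_def)
qed auto

lemma cf_out_nth_eq:
  assumes "k < length (cf_out (otm_config M p q t))" "k < length (cf_out (otm_config M p q t'))"
  shows "cf_out (otm_config M p q t) ! k = cf_out (otm_config M p q t') ! k"
proof -
  consider "t \<le> t'" | "t' \<le> t" by linarith
  then show ?thesis
  proof cases
    case 1 then show ?thesis using cf_out_mono[OF 1, of M p q] assms by (auto simp: nth_append)
  next
    case 2 then show ?thesis using cf_out_mono[OF 2, of M p q] assms by (auto simp: nth_append)
  qed
qed

text \<open>Output is only ever appended, so the least stage in the definition can be replaced by
  any stage that shows the bit.\<close>

lemma otm_fun_eq_Some_iff:
  "otm_fun M p q = Some r \<longleftrightarrow>
     (\<forall>k. \<exists>t. k < length (cf_out (otm_config M p q t)) \<and> cf_out (otm_config M p q t) ! k = r k)"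
proof -
  let ?o = "\<lambda>t. cf_out (otm_config M p q t)"
  have L: "k < length (?o (LEAST t. k < length (?o t)))" if "k < length (?o t)" for k t
    using LeastI[of "\<lambda>t. k < length (?o t)"] that by blast
  show ?thesis
  proof
    assume "otm_fun M p q = Some r"
    then have "\<forall>k. \<exists>t. k < length (?o t)" "r = (\<lambda>k. ?o (LEAST t. k < length (?o t)) ! k)"
      by (auto simp: otm_fun_def split: if_splits)
    then show "\<forall>k. \<exists>t. k < length (?o t) \<and> ?o t ! k = r k" using L by blast
  next
    assume a: "\<forall>k. \<exists>t. k < length (?o t) \<and> ?o t ! k = r k"
    have "?o (LEAST t. k < length (?o t)) ! k = r k" for k
      using a L cf_out_nth_eq by metis
    then show "otm_fun M p q = Some r" using a by (auto simp: otm_fun_def)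
  qed
qed

text \<open>The machine never halts: register 0 counts \<open>k\<close>, each round leaves
  \<open>f p q k\<close> in register 1 and prints one bit, so the output is infinite for all oracles
  and inputs.\<close>

theorem recursive_otm:
  assumes "recursive f"
  obtains n where "\<And>p q. otm_fun (nth_otm n) p q = Some (\<lambda>k. f p q k \<noteq> 0)"
proof -
  obtain T where T: "realizable T" "\<And>p q \<sigma>. T p q \<sigma> Oracle = \<sigma> Oracle"
    "\<And>p q \<sigma>. T p q \<sigma> Input = \<sigma> Input"
    "\<And>p q \<sigma> w. w < 2 \<Longrightarrow> w \<noteq> 1 \<Longrightarrow> T p q \<sigma> (Work w) = \<sigma> (Work w)"
    "\<And>p q \<sigma>. \<sigma> Oracle = 0 \<Longrightarrow> \<sigma> Input = 0 \<Longrightarrow> T p q \<sigma> (Work 1) = f p q (\<sigma> (Work 0))"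
    using recursive_program[OF assms, of 0 2 1] by auto
  obtain V code n where "implements V code n T" using T(1) by (auto simp: realizable_def)
  \<comment> \<open>At least two tapes are marked, because register 1 is tested after the
    body.\<close>
  then obtain W where W: "implements W code n T" "2 \<le> W"
    by (metis implements_mono max.cobounded1 max.cobounded2)
  have len: "length (code b) = n" for b using W by (simp add: implements_def)
  define e where "e = W + n"
  \<comment> \<open>The marker writes fill the addresses below \<open>W\<close>, so the body starts
    at \<open>W\<close>; the result is tested right behind it, at \<open>e\<close>. Address
    \<open>e + 4\<close> prints \<open>0\<close>, address \<open>e + 5\<close> advances the counter,
    and paired oracle jumps are unconditional.\<close>
  define M where "M = map (\<lambda>w. Write w 1) [0..<W] @ code W @
    [JumpIf (Work 1) 1 (e + 4), Output True, JumpIf Oracle 0 (e + 5), JumpIf Oracle 1 (e + 5),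
     Output False, MoveRight (Work 0), JumpIf Oracle 0 W, JumpIf Oracle 1 W]"
  have "segment M 0 M" by (simp add: segment_def)
  then have "segment M 0 (map (\<lambda>w. Write w 1) [0..<W] @ code W @
    [JumpIf (Work 1) 1 (e + 4), Output True, JumpIf Oracle 0 (e + 5), JumpIf Oracle 1 (e + 5),
     Output False, MoveRight (Work 0), JumpIf Oracle 0 W, JumpIf Oracle 1 W])"
    unfolding M_def by blast
  then have seg: "segment M W (code W)" and segw: "segment M 0 (map (\<lambda>w. Write w 1) [0..<W])"
    and M: "length M \<ge> e + 8" "M ! e = JumpIf (Work 1) 1 (e + 4)" "M ! (e + 1) = Output True"
     "M ! (e + 2) = JumpIf Oracle 0 (e + 5)"
     "M ! (e + 3) = JumpIf Oracle 1 (e + 5)" "M ! (e + 4) = Output False"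
     "M ! (e + 5) = MoveRight (Work 0)" "M ! (e + 6) = JumpIf Oracle 0 W" "M ! (e + 7) = JumpIf Oracle 1 W"
    by (simp_all add: len e_def[symmetric] eval_nat_numeral)
  have Mw: "M ! w = Write w 1" "w < length M" if "w < W" for w
    using segw that by (auto simp: segment_def)
  have jump: "reaches M p q c (c\<lparr>cf_pos := l\<rparr>)"
    if "M ! cf_pos c = JumpIf Oracle 0 l" "M ! Suc (cf_pos c) = JumpIf Oracle 1 l"
      "Suc (cf_pos c) < length M" for p q c l
  proof (cases "p (cf_head c Oracle)")
    case True
    have "reaches M p q (c\<lparr>cf_pos := Suc (cf_pos c)\<rparr>) (c\<lparr>cf_pos := l\<rparr>)"
      by (rule reaches_step) (use that True in \<open>auto intro: reaches_refl\<close>)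
    with that True show ?thesis
      by (intro reaches_step[of c]) auto
  next
    case False
    with that show ?thesis
      by (intro reaches_step[of c]) (auto intro: reaches_refl)
  qed
  \<comment> \<open>Invariant at the loop entry \<open>W\<close>: \<open>k\<close> bits are printed
    and both read heads are back at cell 0.\<close>
  have inv: "\<exists>c. reaches M p q init_config c \<and> cf_pos c = W \<and> markers W c \<and>
      cf_head c Oracle = 0 \<and> cf_head c Input = 0 \<and> cf_head c (Work 0) = k \<and>
      cf_out c = map (\<lambda>k. f p q k \<noteq> 0) [0..<k]" for p q k
  proof (induction k)
    case 0
    have "w \<le> W \<Longrightarrow> \<exists>c. reaches M p q init_config c \<and> cf_pos c = w \<and> markers w c \<and>
      cf_head c = (\<lambda>_. 0) \<and> (\<forall>v\<ge>w. \<forall>i. cf_cells c v i = 0) \<and> cf_out c = []" for w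
    proof (induction w)
      case 0
      show ?case
        by (rule exI[of _ init_config]) (auto simp: markers_def init_config_def reaches_refl)
    next
      case (Suc w)
      then obtain c where c: "reaches M p q init_config c" "cf_pos c = w" "markers w c"
        "cf_head c = (\<lambda>_. 0)" "\<forall>v\<ge>w. \<forall>i. cf_cells c v i = 0" "cf_out c = []" by auto
      let ?c = "exec_instr p q (Write w 1) c"
      have "reaches M p q c ?c"
        using Mw[of w] Suc.prems c(2) by (intro reaches_step[of c]) (auto intro: reaches_refl)
      with c(1) have "reaches M p q init_config ?c" by (rule reaches_trans)
      with c show ?case
        by (intro exI[of _ ?c]) (auto simp: markers_def less_Suc_eq fun_eq_iff)
    qed
    from this[of W] show ?case by auto
  next
    case (Suc k)
    then obtain c where c: "reaches M p q init_config c" "cf_pos c = W" "markers W c"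
      "cf_head c Oracle = 0" "cf_head c Input = 0" "cf_head c (Work 0) = k"
      "cf_out c = map (\<lambda>k. f p q k \<noteq> 0) [0..<k]" by auto
    let ?h = "T p q (cf_head c)"
    have h: "?h Oracle = 0" "?h Input = 0" "?h (Work 0) = k" "?h (Work (Suc 0)) = f p q k"
      using c T(2-) by auto
    define c1 where "c1 = c\<lparr>cf_pos := e, cf_head := ?h\<rparr>"
    have 1: "reaches M p q c c1"
      by (rule implementsD[OF W(1) seg]) (use c in \<open>auto simp: c1_def e_def intro: reaches_refl\<close>)
    have swap: "c\<lparr>cf_head := h, cf_pos := l, cf_out := bs\<rparr> = c\<lparr>cf_head := h, cf_out := bs, cf_pos := l\<rparr>" for l bs h
      by (cases c) simp
    define c2 where "c2 = c1\<lparr>cf_out := cf_out c @ [f p q k \<noteq> 0], cf_pos := e + 5\<rparr>"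
    have cells: "cf_cells c (Suc 0) = (\<lambda>i. of_bool (i = 0))" using c(3) W(2) by (auto simp: markers_def)
    have 2: "reaches M p q c1 c2"
    proof (cases "f p q k = 0")
      case True
      have "reaches M p q (c1\<lparr>cf_pos := e + 4\<rparr>) c2"
        by (rule reaches_step) (use M True in \<open>auto simp: c1_def c2_def swap add.commute intro: reaches_refl\<close>)
      with M True show ?thesis
        by (intro reaches_step[of c1]) (auto simp: c1_def cells h)
    next
      case False
      have "reaches M p q (c2\<lparr>cf_pos := e + 2\<rparr>) (c2\<lparr>cf_pos := e + 2\<rparr>\<lparr>cf_pos := e + 5\<rparr>)"
        using M by (intro jump) (auto simp: eval_nat_numeral)
      then have "reaches M p q (c2\<lparr>cf_pos := e + 2\<rparr>) c2"
        by (simp add: c2_def)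
      then have "reaches M p q (c1\<lparr>cf_pos := e + 1\<rparr>) c2"
        using M False by (intro reaches_step[of "c1\<lparr>cf_pos := e + 1\<rparr>"]) (auto simp: c1_def c2_def swap)
      with M False show ?thesis
        by (intro reaches_step[of c1]) (auto simp: c1_def cells h)
    qed
    define c3 where "c3 = c2\<lparr>cf_pos := e + 6, cf_head := ?h(Work 0 := Suc k)\<rparr>"
    have 3: "reaches M p q c2 c3"
      by (rule reaches_step) (use M in \<open>auto simp: c1_def c2_def c3_def h add.commute intro: reaches_refl\<close>)
    have 4: "reaches M p q c3 (c3\<lparr>cf_pos := W\<rparr>)"
      using M by (intro jump) (auto simp: c3_def eval_nat_numeral)
    have "reaches M p q init_config (c3\<lparr>cf_pos := W\<rparr>)"
      using c(1) 1 2 3 4 reaches_trans by blast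
    then show ?case
      using c(3,7) h by (intro exI[of _ "c3\<lparr>cf_pos := W\<rparr>"]) (auto simp: c1_def c2_def c3_def)
  qed
  have "otm_fun M p q = Some (\<lambda>k. f p q k \<noteq> 0)" for p q
    unfolding otm_fun_eq_Some_iff
  proof
    fix k
    obtain c where "reaches M p q init_config c" "cf_out c = map (\<lambda>k. f p q k \<noteq> 0) [0..<Suc k]"
      using inv[of p q "Suc k"] by blast
    moreover from this(1) obtain t where "otm_config M p q t = c"
      by (auto simp: reaches_def otm_config_def)
    ultimately show "\<exists>t. k < length (cf_out (otm_config M p q t)) \<and>
        cf_out (otm_config M p q t) ! k = (f p q k \<noteq> 0)"
      by (intro exI[of _ t]) (simp add: nth_append)
  qed
  moreover obtain m where "nth_otm m = M" using surj_nth_otm by (metis surjD)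
  ultimately show ?thesis using that by blast
qed

section \<open>Closure properties of recursive functionals\<close>

definition nfst :: "nat \<Rightarrow> nat" where "nfst z = fst (prod_decode z)"
definition nsnd :: "nat \<Rightarrow> nat" where "nsnd z = snd (prod_decode z)"
definition npair :: "nat \<Rightarrow> nat \<Rightarrow> nat" where "npair x y = prod_encode (x, y)"

lemma nfst_npair [simp]: "nfst (npair x y) = x" and nsnd_npair [simp]: "nsnd (npair x y) = y"
  by (simp_all add: nfst_def nsnd_def npair_def)

lemma npair_eq_iff [simp]: "npair x y = npair x' y' \<longleftrightarrow> x = x' \<and> y = y'"
  by (simp add: npair_def)

lemma nfst_zero [simp]: "nfst 0 = 0" and nsnd_zero [simp]: "nsnd 0 = 0"
  by (simp_all add: nfst_def nsnd_def prod_decode_funpow)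

lemma nsnd_le: "nsnd z \<le> z"
  using le_prod_encode_2[of "nsnd z" "nfst z"] by (simp add: nfst_def nsnd_def)

lemma recursive_nfst: "recursive f \<Longrightarrow> recursive (\<lambda>p q x. nfst (f p q x))"
  and recursive_nsnd: "recursive f \<Longrightarrow> recursive (\<lambda>p q x. nsnd (f p q x))"
  unfolding nfst_def nsnd_def by (fact recursive_unpair)+

lemma recursive_npair:
  "recursive f \<Longrightarrow> recursive g \<Longrightarrow> recursive (\<lambda>p q x. npair (f p q x) (g p q x))"
  unfolding npair_def by (fact recursive_pair)

lemma recursive_const: "recursive (\<lambda>p q x. n)"
  by (induction n) (auto intro: recursive_zero recursive_Suc)

lemma recursive_comp2:
  assumes "recursive (\<lambda>p q z. F p q (nfst z) (nsnd z))" "recursive f" "recursive g"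
  shows "recursive (\<lambda>p q x. F p q (f p q x) (g p q x))"
  using recursive_comp[OF assms(1) recursive_npair[OF assms(2,3)]] by simp

text \<open>The step may depend on the argument \<open>x\<close>, which is carried unchanged in the
  first component of the iterated pair.\<close>

lemma recursive_funpow:
  assumes "recursive (\<lambda>p q z. F p q (nfst z) (nsnd z))" "recursive g" "recursive h"
  shows "recursive (\<lambda>p q x. (F p q x ^^ g p q x) (h p q x))"
proof -
  let ?G = "\<lambda>p q z. npair (nfst z) (F p q (nfst z) (nsnd z))"
  have "recursive ?G"
    by (intro recursive_npair recursive_nfst recursive_id assms)
  then have "recursive (\<lambda>p q x. nsnd ((?G p q ^^ g p q x) (npair x (h p q x))))"
    by (intro recursive_nsnd recursive_nfst recursive_funpow_aux recursive_npair recursive_id assms)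
  moreover have "(?G p q ^^ n) (npair x y) = npair x ((F p q x ^^ n) y)" for p q n x y
    by (induction n) auto
  ultimately show ?thesis by simp
qed

lemma recursive_diff:
  assumes "recursive f" "recursive g"
  shows "recursive (\<lambda>p q x. f p q x - g p q x)"
proof -
  \<comment> \<open>Predecessor by counting with a delay: after \<open>n\<close> rounds from
    \<open>0\<close>, the code of the pair of zeros, the components are \<open>n - 1\<close> and
    \<open>n\<close>.\<close>
  let ?F = "\<lambda>y. npair (nsnd y) (Suc (nsnd y))"
  have "npair 0 0 = 0" by (simp add: npair_def prod_encode_def)
  then have "(?F ^^ n) 0 = npair (n - 1) n" for n by (induction n) auto
  then have "nfst ((?F ^^ n) 0) = n - 1" for n by simp
  moreover have "recursive (\<lambda>p q x. nfst ((?F ^^ x) 0))"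
    by (intro recursive_nfst recursive_funpow recursive_npair recursive_nsnd recursive_Suc
        recursive_id recursive_const)
  ultimately have pred: "recursive (\<lambda>p q x. x - 1)" by simp
  have "recursive (\<lambda>p q x. ((\<lambda>y. y - 1) ^^ g p q x) (f p q x))"
    by (intro recursive_funpow assms recursive_comp[OF pred recursive_nsnd] recursive_id)
  moreover have "((\<lambda>y. y - 1) ^^ n) m = m - n" for n m :: nat
    by (induction n) auto
  ultimately show ?thesis by simp
qed

lemma recursive_add:
  assumes "recursive f" "recursive g"
  shows "recursive (\<lambda>p q x. f p q x + g p q x)"
proof -
  have "recursive (\<lambda>p q x. (Suc ^^ g p q x) (f p q x))"
    by (intro recursive_funpow assms recursive_Suc recursive_nsnd recursive_id)
  then show ?thesis by (simp add: Suc_funpow add.commute)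
qed

section \<open>Decidable predicates\<close>

definition decidable :: "(cantor \<Rightarrow> cantor \<Rightarrow> nat \<Rightarrow> bool) \<Rightarrow> bool" where
  "decidable P \<longleftrightarrow> recursive (\<lambda>p q x. of_bool (P p q x))"

lemma recursive_of_bool: "decidable P \<Longrightarrow> recursive (\<lambda>p q x. of_bool (P p q x))"
  by (simp add: decidable_def)

text \<open>A case distinction is the iteration of a constant function, zero times or once.\<close>

lemma recursive_if:
  assumes "decidable P" "recursive f" "recursive g"
  shows "recursive (\<lambda>p q x. if P p q x then f p q x else g p q x)"
proof -
  have "recursive (\<lambda>p q x. ((\<lambda>_. f p q x) ^^ of_bool (P p q x)) (g p q x))"
    by (intro recursive_funpow recursive_comp[OF assms(2)] recursive_of_bool assms recursive_nfst recursive_id)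
  then show ?thesis
    by (rule back_subst[where P = recursive]) (auto simp: fun_eq_iff)
qed

lemma decidable_const: "decidable (\<lambda>p q x. b)"
  by (simp add: decidable_def recursive_const)

lemma decidable_not: "decidable P \<Longrightarrow> decidable (\<lambda>p q x. \<not> P p q x)"
proof -
  assume "decidable P"
  then have "recursive (\<lambda>p q x. 1 - of_bool (P p q x))"
    by (intro recursive_diff recursive_const recursive_of_bool)
  then show ?thesis
    unfolding decidable_def by (rule back_subst[where P = recursive]) (auto simp: fun_eq_iff)
qed

lemma decidable_conj: "decidable P \<Longrightarrow> decidable Q \<Longrightarrow> decidable (\<lambda>p q x. P p q x \<and> Q p q x)"
proof -
  assume "decidable P" "decidable Q"
  then have "recursive (\<lambda>p q x. if P p q x then of_bool (Q p q x) else 0)"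
    by (intro recursive_if recursive_of_bool recursive_const)
  then show ?thesis
    unfolding decidable_def by (rule back_subst[where P = recursive]) (auto simp: fun_eq_iff)
qed

lemma decidable_eq_zero:
  "recursive f \<Longrightarrow> decidable (\<lambda>p q x. f p q x = 0)"
proof -
  assume "recursive f"
  then have "recursive (\<lambda>p q x. 1 - f p q x)"
    by (intro recursive_diff recursive_const)
  then show ?thesis
    unfolding decidable_def by (rule back_subst[where P = recursive]) (auto simp: fun_eq_iff)
qed

lemma decidable_le:
  "recursive f \<Longrightarrow> recursive g \<Longrightarrow> decidable (\<lambda>p q x. f p q x \<le> g p q x)"
  using decidable_eq_zero[OF recursive_diff, of f g] by simp

lemma decidable_less:
  "recursive f \<Longrightarrow> recursive g \<Longrightarrow> decidable (\<lambda>p q x. f p q x < g p q x)"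
  using decidable_le[OF recursive_Suc, of f g] by (simp add: Suc_le_eq)

lemma decidable_eq:
  "recursive f \<Longrightarrow> recursive g \<Longrightarrow> decidable (\<lambda>p q x. f p q x = g p q x)"
  using decidable_conj[OF decidable_le decidable_le, of f g g f] by (simp add: eq_iff)

lemma decidable_odd:
  assumes "recursive f"
  shows "decidable (\<lambda>p q x. odd (f p q x))"
proof -
  have "recursive (\<lambda>p q x. ((\<lambda>y. 1 - y) ^^ f p q x) 0)"
    by (intro recursive_funpow recursive_diff recursive_nsnd recursive_id recursive_const assms)
  moreover have "((\<lambda>y. 1 - y) ^^ n) 0 = (of_bool (odd n) :: nat)" for n
    by (induction n) auto
  ultimately show ?thesis by (simp add: decidable_def)
qed

lemma decidable_comp:
  "decidable P \<Longrightarrow> recursive f \<Longrightarrow> decidable (\<lambda>p q x. P p q (f p q x))"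
  unfolding decidable_def by (rule recursive_comp)

lemma decidable_read:
  assumes "recursive f"
  shows "decidable (\<lambda>p q x. p (f p q x))" "decidable (\<lambda>p q x. q (f p q x))"
  using recursive_read[OF assms] by (simp_all add: decidable_def)

lemma decidable_if:
  "decidable P \<Longrightarrow> decidable Q \<Longrightarrow> decidable R \<Longrightarrow>
     decidable (\<lambda>p q x. if P p q x then Q p q x else R p q x)"
proof -
  assume "decidable P" "decidable Q" "decidable R"
  then have "decidable (\<lambda>p q x. \<not> (P p q x \<and> \<not> Q p q x) \<and> \<not> (\<not> P p q x \<and> \<not> R p q x))"
    by (intro decidable_conj decidable_not)
  then show ?thesis by (rule back_subst[where P = decidable]) (auto simp: fun_eq_iff)
qed

lemmas recursive_intros =
  recursive_const recursive_id recursive_Suc recursive_nfst recursive_nsnd recursive_npair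
  recursive_diff recursive_add recursive_of_bool recursive_if decidable_const decidable_not
  decidable_conj decidable_if decidable_le decidable_less decidable_eq decidable_odd decidable_read

section \<open>Simulation of Turing machines\<close>

text \<open>
  Finite-support functions on \<open>nat\<close> are coded by their history of updates; \<open>0\<close> codes the zero
  function. The search for a key in a code \<open>l\<close> takes at most \<open>l\<close> steps.
\<close>

definition walk :: "nat \<Rightarrow> nat \<Rightarrow> nat" where
  "walk key l = (if l = 0 then l else if nfst (nfst (l - 1)) = key then l else nsnd (l - 1))"

definition lookup :: "nat \<Rightarrow> nat \<Rightarrow> nat" where
  "lookup l key = nsnd (nfst ((walk key ^^ l) l - 1))"

definition update :: "nat \<Rightarrow> nat \<Rightarrow> nat \<Rightarrow> nat" where
  "update l key v = Suc (npair (npair key v) l)"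

lemma funpow_fixpoint: "f x = x \<Longrightarrow> (f ^^ n) x = x"
  by (induction n) auto

text \<open>A tail has a smaller code than its list, so \<open>l\<close> steps reach a matching
  entry or \<open>0\<close>. Both are fixed by \<open>walk\<close>, and extra steps change
  nothing.\<close>

lemma walk_stable: "l \<le> n \<Longrightarrow> (walk key ^^ n) l = (walk key ^^ l) l"
proof (induction l arbitrary: n rule: less_induct)
  case (less l)
  show ?case
  proof (cases "walk key l = l")
    case True
    then show ?thesis by (simp add: funpow_fixpoint)
  next
    case False
    then have r: "walk key l = nsnd (l - 1)" "l > 0" by (auto simp: walk_def split: if_splits)
    let ?r = "nsnd (l - 1)"
    have r': "?r \<le> l - 1" by (rule nsnd_le)
    have "(walk key ^^ m) l = (walk key ^^ ?r) ?r" if "l \<le> m" for m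
    proof -
      obtain k where k: "m = Suc k" using \<open>l > 0\<close> \<open>l \<le> m\<close> by (cases m) auto
      have "(walk key ^^ m) l = (walk key ^^ k) ?r"
        unfolding k funpow_Suc_right comp_apply r(1) ..
      also have "\<dots> = (walk key ^^ ?r) ?r"
        by (rule less.IH) (use r' r(2) that k in linarith)+
      finally show ?thesis .
    qed
    from this[OF less.prems] this[OF order_refl] show ?thesis by (rule trans[OF _ sym])
  qed
qed

lemma lookup_zero [simp]: "lookup 0 key = 0"
  by (simp add: lookup_def)

lemma lookup_update: "lookup (update l key v) key' = (if key' = key then v else lookup l key')"
proof (cases "key' = key")
  case True
  then have "walk key' (update l key v) = update l key v" by (simp add: walk_def update_def)
  then have "lookup (update l key v) key' = nsnd (nfst (update l key v - 1))"
    unfolding lookup_def by (simp only: funpow_fixpoint)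
  then show ?thesis using True by (simp add: update_def)
next
  case False
  then have w: "walk key' (update l key v) = l" by (auto simp: walk_def update_def)
  have "l \<le> npair (npair key v) l" by (simp add: npair_def le_prod_encode_2)
  then have "(walk key' ^^ update l key v) (update l key v) = (walk key' ^^ l) l"
    using w walk_stable[of l "npair (npair key v) l" key'] unfolding update_def funpow_Suc_right comp_apply by simp
  then show ?thesis using False unfolding lookup_def by simp
qed

lemma recursive_lookup:
  assumes "recursive f" "recursive g"
  shows "recursive (\<lambda>p q x. lookup (f p q x) (g p q x))"
proof -
  have "recursive (\<lambda>p q z. lookup (nfst z) (nsnd z))"
    unfolding lookup_def walk_def by (intro recursive_intros recursive_funpow)
  then show ?thesis using assms by (rule recursive_comp2)
qed

lemma recursive_update:
  "recursive f \<Longrightarrow> recursive g \<Longrightarrow> recursive h \<Longrightarrow> recursive (\<lambda>p q x. update (f p q x) (g p q x) (h p q x))"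
  unfolding update_def by (intro recursive_intros)

text \<open>\<open>list_decode\<close> codes a nonempty list as the successor of the pair of head
  and tail. Since \<open>nsnd 0 = 0\<close>, dropping past the end stays at \<open>0\<close>, the
  code of the empty list.\<close>

definition remaining :: "nat \<Rightarrow> nat \<Rightarrow> nat" where
  "remaining n i = ((\<lambda>m. nsnd (m - 1)) ^^ i) n"

lemma recursive_remaining:
  "recursive f \<Longrightarrow> recursive g \<Longrightarrow> recursive (\<lambda>p q x. remaining (f p q x) (g p q x))"
  unfolding remaining_def by (intro recursive_intros recursive_funpow)

lemma list_decode_eq: "list_decode m = (if m = 0 then [] else nfst (m - 1) # list_decode (nsnd (m - 1)))"
  by (cases m) (auto simp: nfst_def nsnd_def split: prod.split)

lemma list_decode_remaining: "list_decode (remaining n i) = drop i (list_decode n)"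
proof (induction i)
  case (Suc i)
  have "remaining n (Suc i) = nsnd (remaining n i - 1)" by (simp add: remaining_def)
  moreover have "list_decode (nsnd (m - 1)) = tl (list_decode m)" for m
    by (cases "m = 0") (simp_all add: list_decode_eq[of m])
  ultimately show ?case using Suc by (simp add: drop_Suc tl_drop)
qed (simp add: remaining_def)

lemma remaining_nth_otm:
  "remaining n i = 0 \<longleftrightarrow> length (nth_otm n) \<le> i"
  "i < length (nth_otm n) \<Longrightarrow> nth_otm n ! i = decode_instr (nfst (remaining n i - 1))"
proof -
  note l = list_decode_remaining[of n i]
  have "remaining n i = 0 \<longleftrightarrow> list_decode (remaining n i) = []"
    by (auto simp: list_decode_eq[of "remaining n i"])
  then show 1: "remaining n i = 0 \<longleftrightarrow> length (nth_otm n) \<le> i"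
    using l by (simp add: nth_otm_def)
  assume i: "i < length (nth_otm n)"
  then have "remaining n i \<noteq> 0" using 1 by simp
  then have "hd (drop i (list_decode n)) = nfst (remaining n i - 1)"
    unfolding l[symmetric] by (simp add: list_decode_eq[of "remaining n i"])
  with i show "nth_otm n ! i = decode_instr (nfst (remaining n i - 1))"
    by (simp add: nth_otm_def hd_drop_conv_nth)
qed

text \<open>
  A configuration is coded as an update history: key \<open>(0, 0)\<close> holds the position, \<open>(1, i)\<close> the
  head of tape \<open>i\<close> in the order of \<^const>\<open>decode_tape\<close>, \<open>(2, i)\<close> the \<open>i\<close>-th output bit, \<open>(3, 0)\<close> the
  length of the output, \<open>(w + 4, i)\<close> the \<open>i\<close>-th cell of work tape \<open>w\<close>.
\<close>

definition codes_config :: "nat \<Rightarrow> config \<Rightarrow> bool" where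
  "codes_config l c \<longleftrightarrow> lookup l (npair 0 0) = cf_pos c \<and>
     (\<forall>i. lookup l (npair 1 i) = cf_head c (decode_tape i)) \<and>
     (\<forall>i<length (cf_out c). lookup l (npair 2 i) = of_bool (cf_out c ! i)) \<and>
     lookup l (npair 3 0) = length (cf_out c) \<and>
     (\<forall>w i. lookup l (npair (w + 4) i) = cf_cells c w i)"

text \<open>Tape index \<open>i \<ge> 2\<close> is work tape \<open>i - 2\<close>, and cells of work
  tape \<open>w\<close> have first key \<open>w + 4\<close>; hence the key
  \<open>i + 2\<close>.\<close>

definition sim_scan :: "cantor \<Rightarrow> cantor \<Rightarrow> nat \<Rightarrow> nat \<Rightarrow> nat" where
  "sim_scan r s l i =
     (if i = 0 then of_bool (r (lookup l (npair 1 i)))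
      else if i = 1 then of_bool (s (lookup l (npair 1 i)))
      else lookup l (npair (i + 2) (lookup l (npair 1 i))))"

definition sim_next :: "nat \<Rightarrow> nat" where
  "sim_next l = update l (npair 0 0) (Suc (lookup l (npair 0 0)))"

text \<open>\<open>k\<close> and \<open>a\<close> are operation code and argument as in
  \<open>decode_instr\<close>. In a write, \<open>nfst a\<close> is a work tape number; the head of
  that tape is stored at tape index \<open>nfst a + 2\<close>.\<close>

definition sim_exec :: "cantor \<Rightarrow> cantor \<Rightarrow> nat \<Rightarrow> nat \<Rightarrow> nat \<Rightarrow> nat" where
  "sim_exec r s k a l =
     (if k = 0 then update (sim_next l) (npair 1 a) (lookup l (npair 1 a) - 1)
      else if k = 1 then update (sim_next l) (npair 1 a) (Suc (lookup l (npair 1 a)))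
      else if k = 2 then
        update (sim_next l) (npair (nfst a + 4) (lookup l (npair 1 (nfst a + 2)))) (nsnd a)
      else if k = 3 then
        (if sim_scan r s l (nfst a) = nfst (nsnd a) then update l (npair 0 0) (nsnd (nsnd a))
         else sim_next l)
      else update (update (sim_next l) (npair 2 (lookup l (npair 3 0))) (of_bool (odd a)))
        (npair 3 0) (Suc (lookup l (npair 3 0))))"

definition sim_step :: "nat \<Rightarrow> cantor \<Rightarrow> cantor \<Rightarrow> nat \<Rightarrow> nat" where
  "sim_step n r s l =
     (if remaining n (lookup l (npair 0 0)) = 0 then l
      else sim_exec r s (nfst (nfst (remaining n (lookup l (npair 0 0)) - 1)))
        (nsnd (nfst (remaining n (lookup l (npair 0 0)) - 1))) l)"

lemma decode_instr_cases:
  "decode_instr m =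
     (if nfst m = 0 then MoveLeft (decode_tape (nsnd m))
      else if nfst m = 1 then MoveRight (decode_tape (nsnd m))
      else if nfst m = 2 then Write (nfst (nsnd m)) (nsnd (nsnd m))
      else if nfst m = 3 then
        JumpIf (decode_tape (nfst (nsnd m))) (nfst (nsnd (nsnd m))) (nsnd (nsnd (nsnd m)))
      else Output (odd (nsnd m)))"
  by (simp add: decode_instr_def nfst_def nsnd_def Let_def split: prod.split)

lemma decode_tape_eq_iff [simp]: "decode_tape i = decode_tape j \<longleftrightarrow> i = j"
  by (cases i rule: decode_tape.cases; cases j rule: decode_tape.cases) auto

lemma sim_scan:
  assumes "codes_config l c"
  shows "sim_scan r s l i = scanned r s c (decode_tape i)"
proof -
  have "lookup l (npair (Suc (Suc w) + 2) j) = cf_cells c w j" for w j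
    using assms by (simp add: codes_config_def eval_nat_numeral)
  then show ?thesis
    using assms by (cases i rule: decode_tape.cases) (auto simp: sim_scan_def codes_config_def)
qed

lemma codes_config_exec:
  assumes "codes_config l c"
  shows "codes_config (sim_exec r s (nfst m) (nsnd m) l) (exec_instr r s (decode_instr m) c)"
proof -
  consider "nfst m = 0" | "nfst m = 1" | "nfst m = 2" | "nfst m = 3" | "nfst m > 3" by linarith
  then show ?thesis
  proof cases
    case 4
    then show ?thesis
      using assms sim_scan[OF assms, of r s]
      by (auto simp: codes_config_def decode_instr_cases sim_exec_def sim_next_def lookup_update)
  qed (use assms in \<open>auto simp: codes_config_def decode_instr_cases sim_exec_def sim_next_def
      lookup_update nth_append less_Suc_eq\<close>)
qed

lemma codes_config_step:
  assumes "codes_config l c"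
  shows "codes_config (sim_step n r s l) (otm_step (nth_otm n) r s c)"
proof -
  have l: "lookup l (npair 0 0) = cf_pos c" using assms by (simp add: codes_config_def)
  show ?thesis
    using codes_config_exec[OF assms, of r s] assms
    by (auto simp: sim_step_def otm_step_def l remaining_nth_otm)
qed

lemma codes_config_funpow:
  "codes_config ((sim_step n r s ^^ t) 0) (otm_config (nth_otm n) r s t)"
proof (induction t)
  case 0
  \<comment> \<open>The code \<open>0\<close> is the zero function, and the initial configuration
    has only zeros and an empty output.\<close>
  show ?case by (simp add: otm_config_def codes_config_def init_config_def)
next
  case (Suc t)
  then show ?case using codes_config_step by (simp add: otm_config_def)
qed

section \<open>Simulation with computed oracles and inputs\<close>

text \<open>Oracle and input of a simulated machine are themselves computed from \<open>p\<close>,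
  \<open>q\<close> and the argument, hence families of sequences indexed by the argument.\<close>

definition recursive_seq :: "(cantor \<Rightarrow> cantor \<Rightarrow> nat \<Rightarrow> cantor) \<Rightarrow> bool" where
  "recursive_seq A \<longleftrightarrow> decidable (\<lambda>p q z. A p q (nfst z) (nsnd z))"

lemma decidable_seq:
  assumes "recursive_seq A" "recursive f" "recursive g"
  shows "decidable (\<lambda>p q x. A p q (f p q x) (g p q x))"
  using decidable_comp[OF assms(1)[unfolded recursive_seq_def] recursive_npair[OF assms(2,3)]] by simp

lemma recursive_seq_comp:
  assumes "recursive_seq A" "recursive f"
  shows "recursive_seq (\<lambda>p q x. A p q (f p q x))"
  unfolding recursive_seq_def
  by (intro decidable_seq[OF assms(1)] recursive_comp[OF assms(2)] recursive_nfst recursive_nsnd recursive_id)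

lemma recursive_sim_scan:
  assumes "recursive_seq A" "recursive_seq B" "recursive l" "recursive i"
  shows "recursive (\<lambda>p q x. sim_scan (A p q x) (B p q x) (l p q x) (i p q x))"
  unfolding sim_scan_def
  by (intro recursive_intros recursive_lookup decidable_seq[OF assms(1)] decidable_seq[OF assms(2)] assms)

lemma recursive_sim_next: "recursive l \<Longrightarrow> recursive (\<lambda>p q x. sim_next (l p q x))"
  unfolding sim_next_def by (intro recursive_intros recursive_update recursive_lookup)

lemma recursive_sim_exec:
  assumes "recursive_seq A" "recursive_seq B" "recursive k" "recursive a" "recursive l"
  shows "recursive (\<lambda>p q x. sim_exec (A p q x) (B p q x) (k p q x) (a p q x) (l p q x))"
  unfolding sim_exec_def
  by (intro recursive_intros recursive_update recursive_lookup recursive_sim_scan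
      recursive_sim_next assms)

lemma recursive_sim_step:
  assumes "recursive_seq A" "recursive_seq B" "recursive n" "recursive l"
  shows "recursive (\<lambda>p q x. sim_step (n p q x) (A p q x) (B p q x) (l p q x))"
  unfolding sim_step_def
  by (intro recursive_intros recursive_sim_exec recursive_lookup recursive_remaining assms)

text \<open>A universal machine cut off after \<open>t\<close> steps: index, oracle, input and
  number of steps may all vary with \<open>x\<close>, and the cut-off keeps it total.\<close>

lemma recursive_sim:
  assumes "recursive_seq A" "recursive_seq B" "recursive n" "recursive t"
  shows "recursive (\<lambda>p q x. (sim_step (n p q x) (A p q x) (B p q x) ^^ t p q x) 0)"
  by (intro recursive_funpow recursive_sim_step recursive_seq_comp[OF assms(1)]
      recursive_seq_comp[OF assms(2)] recursive_comp[OF assms(3)] recursive_intros assms)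

abbreviation output_at :: "nat \<Rightarrow> cantor \<Rightarrow> cantor \<Rightarrow> nat \<Rightarrow> bool list" where
  "output_at n r s t \<equiv> cf_out (otm_config (nth_otm n) r s t)"

lemma recursive_length_output:
  assumes "recursive_seq A" "recursive_seq B" "recursive n" "recursive t"
  shows "recursive (\<lambda>p q x. length (output_at (n p q x) (A p q x) (B p q x) (t p q x)))"
proof -
  have "recursive (\<lambda>p q x. lookup ((sim_step (n p q x) (A p q x) (B p q x) ^^ t p q x) 0) (npair 3 0))"
    by (intro recursive_lookup recursive_sim recursive_intros assms)
  then show ?thesis using codes_config_funpow by (simp add: codes_config_def)
qed

definition output_true :: "nat \<Rightarrow> cantor \<Rightarrow> cantor \<Rightarrow> nat \<Rightarrow> nat \<Rightarrow> bool" where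
  "output_true n r s t i \<longleftrightarrow> i < length (output_at n r s t) \<and> output_at n r s t ! i"

lemma decidable_output_true:
  assumes "recursive_seq A" "recursive_seq B" "recursive n" "recursive t" "recursive i"
  shows "decidable (\<lambda>p q x. output_true (n p q x) (A p q x) (B p q x) (t p q x) (i p q x))"
proof -
  have "decidable (\<lambda>p q x. i p q x < length (output_at (n p q x) (A p q x) (B p q x) (t p q x)) \<and>
    lookup ((sim_step (n p q x) (A p q x) (B p q x) ^^ t p q x) 0) (npair 2 (i p q x)) \<noteq> 0)"
    by (intro recursive_lookup recursive_sim recursive_intros recursive_length_output assms)
  then show ?thesis
    by (rule back_subst[where P = decidable])
      (use codes_config_funpow in \<open>auto simp: codes_config_def output_true_def fun_eq_iff\<close>)
qed

section \<open>Acceptance\<close>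

text \<open>For \<open>w = 0\<^sup>n1p\<close> and large \<open>s\<close> this is \<open>n\<close>.\<close>

definition first_one :: "cantor \<Rightarrow> nat \<Rightarrow> nat" where
  "first_one w s = ((\<lambda>i. if w i then i else Suc i) ^^ s) 0"

lemma first_one_zeros: "i < first_one w s \<Longrightarrow> \<not> w i"
  unfolding first_one_def by (induction s) (auto split: if_splits simp: less_Suc_eq)

lemma index_prefix_first_one:
  "w (first_one w s) \<Longrightarrow> w = index_prefix (first_one w s) (\<lambda>j. w (Suc (first_one w s + j)))"
  by (auto simp: index_prefix_def fun_eq_iff first_one_zeros dest: less_antisym)

lemma first_one_index_prefix: "first_one (index_prefix n p) n = n"
proof -
  have "first_one (index_prefix n p) s = s" if "s \<le> n" for s
    using that by (induction s) (auto simp: first_one_def index_prefix_def)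
  then show ?thesis by simp
qed

text \<open>\<open>s\<close> bounds the search for the first \<open>1\<close> of \<open>w\<close>.
  The first conjunct says that the search has succeeded; only then is \<open>first_one w s\<close>
  the index coded in \<open>w\<close>.\<close>

definition accept_stage :: "cantor \<Rightarrow> cantor \<Rightarrow> nat \<Rightarrow> nat \<Rightarrow> nat \<Rightarrow> bool" where
  "accept_stage w q s t i \<longleftrightarrow> w (first_one w s) \<and>
     output_true (first_one w s) (\<lambda>j. w (Suc (first_one w s + j))) q t i"

lemma recursive_first_one:
  assumes "recursive_seq A" "recursive s"
  shows "recursive (\<lambda>p q x. first_one (A p q x) (s p q x))"
  unfolding first_one_def
  by (intro recursive_funpow recursive_intros decidable_seq[OF assms(1)] assms)

lemma decidable_accept_stage:
  assumes "recursive_seq A" "recursive_seq B" "recursive s" "recursive t" "recursive i"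
  shows "decidable (\<lambda>p q x. accept_stage (A p q x) (B p q x) (s p q x) (t p q x) (i p q x))"
  unfolding accept_stage_def
proof (intro decidable_conj decidable_output_true)
  show "recursive_seq (\<lambda>p q x j. A p q x (Suc (first_one (A p q x) (s p q x) + j)))"
    unfolding recursive_seq_def
    by (intro decidable_seq[OF assms(1)] recursive_intros
        recursive_comp[OF recursive_first_one[OF assms(1,3)]])
qed (use assms in \<open>auto intro!: decidable_seq recursive_first_one recursive_intros\<close>)

text \<open>A plain search without any promise: it makes sense even if the coded machine is not
  total on \<open>q\<close> or \<open>w\<close> names no open set.\<close>

definition accepts :: "cantor \<Rightarrow> cantor \<Rightarrow> bool" where
  "accepts w q \<longleftrightarrow> (\<exists>n p t i. w = index_prefix n p \<and> output_true n p q t i)"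

lemma accepts_index_prefix: "accepts (index_prefix n p) q \<longleftrightarrow> (\<exists>t i. output_true n p q t i)"
  unfolding accepts_def using index_prefix_inject by blast

lemma accepts_iff_stage: "accepts w q \<longleftrightarrow> (\<exists>s t i. accept_stage w q s t i)"
proof
  assume "accepts w q"
  then obtain n p t i where w: "w = index_prefix n p" "output_true n p q t i"
    by (auto simp: accepts_def)
  have "first_one w n = n" using w first_one_index_prefix by simp
  moreover have "w n" "(\<lambda>j. w (Suc (n + j))) = p" by (auto simp: w index_prefix_def)
  ultimately show "\<exists>s t i. accept_stage w q s t i"
    using w(2) unfolding accept_stage_def by metis
next
  assume "\<exists>s t i. accept_stage w q s t i"
  then show "accepts w q"
    unfolding accepts_def accept_stage_def using index_prefix_first_one by metis
qed

lemma accepts_otm_fun: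
  assumes "otm_fun (nth_otm n) p q = Some r"
  shows "accepts (index_prefix n p) q \<longleftrightarrow> r \<noteq> zero_seq"
proof -
  have "\<exists>t. k < length (output_at n p q t) \<and> output_at n p q t ! k = r k" for k
    using assms by (simp add: otm_fun_eq_Some_iff)
  then show ?thesis
    unfolding accepts_index_prefix output_true_def zero_seq_def fun_eq_iff
    using cf_out_nth_eq by metis
qed

section \<open>Finite use of oracle and input\<close>

text \<open>A head moves by at most one cell per step, so \<open>t\<close> steps read only cells
  below \<open>t\<close>.\<close>

lemma otm_config_cong:
  assumes "\<And>k. k < t \<Longrightarrow> p k = p' k" "\<And>k. k < t \<Longrightarrow> q k = q' k"
  shows "otm_config M p q t = otm_config M p' q' t"
proof -
  have head: "cf_head (otm_config M p q s) a \<le> s" for s a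
  proof (induction s arbitrary: a)
    case (Suc s)
    have "cf_head (exec_instr p q i c) a \<le> Suc s" if "\<And>a. cf_head c a \<le> s" for i c
      using that[of a] by (cases i) (auto intro: le_SucI diff_le_self[THEN order_trans])
    then show ?case using Suc by (auto simp: otm_config_def otm_step_def intro: le_SucI)
  qed (simp add: otm_config_def init_config_def)
  have "otm_config M p q s = otm_config M p' q' s" if "s \<le> t" for s
    using that
  proof (induction s)
    case (Suc s)
    let ?c = "otm_config M p q s"
    have "p (cf_head ?c Oracle) = p' (cf_head ?c Oracle)" "q (cf_head ?c Input) = q' (cf_head ?c Input)"
      using Suc.prems by (auto intro!: assms le_less_trans[OF head])
    then have "scanned p q ?c a = scanned p' q' ?c a" for a
      by (cases a) auto
    then have "exec_instr p q i ?c = exec_instr p' q' i ?c" for i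
      by (cases i) simp_all
    then have "otm_step M p q ?c = otm_step M p' q' ?c" by (simp add: otm_step_def)
    then show ?case using Suc by (simp add: otm_config_def)
  qed (simp add: otm_config_def)
  then show ?thesis by simp
qed

lemma first_one_cong:
  assumes "first_one w s < L" "\<And>k. k < L \<Longrightarrow> w k = w' k"
  shows "first_one w' s = first_one w s"
  using assms(1)
proof (induction s)
  case (Suc s)
  have S: "first_one v (Suc s) = (if v (first_one v s) then first_one v s else Suc (first_one v s))" for v
    by (simp add: first_one_def)
  have "first_one w s < L" using Suc.prems by (simp add: S split: if_splits)
  then show ?case using Suc.IH assms(2) by (simp add: S)
qed (simp add: first_one_def)

text \<open>With the first \<open>1\<close> of \<open>w\<close> at cell \<open>n\<close>, the oracle
  starts at cell \<open>n + 1\<close>, and \<open>t\<close> steps read it up to cell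
  \<open>n + t\<close> at most; this explains the bound on \<open>L\<close>.\<close>

lemma accept_stage_cong:
  assumes "accept_stage w q s t i" "first_one w s + t < L"
    and w: "\<And>k. k < L \<Longrightarrow> w k = w' k" and q: "\<And>k. k < t \<Longrightarrow> q k = q' k"
  shows "accept_stage w' q' s t i"
proof -
  let ?n = "first_one w s"
  have n: "first_one w' s = ?n" using assms(2) by (intro first_one_cong[OF _ w]) auto
  have "output_at ?n (\<lambda>j. w (Suc (?n + j))) q t = output_at ?n (\<lambda>j. w' (Suc (?n + j))) q' t"
    using assms(2) by (intro arg_cong[where f = cf_out] otm_config_cong w q) auto
  then show ?thesis
    using assms(1,2) w by (simp add: accept_stage_def n output_true_def)
qed

section \<open>Finite use and topology\<close>

definition agree :: "nat \<Rightarrow> cantor \<Rightarrow> cantor \<Rightarrow> bool" where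
  "agree N p q \<longleftrightarrow> (\<forall>k<N. p k = q k)"

lemma agree_mono: "agree N p q \<Longrightarrow> M \<le> N \<Longrightarrow> agree M p q"
  by (auto simp: agree_def)

lemma agree_refl [simp]: "agree N p p"
  by (simp add: agree_def)

lemma open_agree: "open {q. agree N p q}"
proof -
  have "open {q :: cantor. q k = p k}" for k
  proof -
    have "open ((\<lambda>q :: cantor. q k) -` {p k})"
      by (intro open_vimage open_discrete continuous_on_product_coordinates)
    then show ?thesis by (simp add: vimage_def)
  qed
  then have "open (\<Inter>k\<in>{..<N}. {q :: cantor. q k = p k})" by (intro open_INT) auto
  moreover have "(\<Inter>k\<in>{..<N}. {q :: cantor. q k = p k}) = {q. agree N p q}"
    by (auto simp: agree_def)
  ultimately show ?thesis by simp
qed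

lemma open_cantor_agree:
  assumes "open V" "q \<in> V"
  obtains N where "\<And>q'. agree N q q' \<Longrightarrow> q' \<in> V"
proof -
  have "openin (product_topology (\<lambda>i. euclidean) (UNIV :: nat set)) V"
    using assms(1) by (simp add: open_fun_def)
  then obtain Z where Z: "q \<in> (\<Pi>\<^sub>E i\<in>UNIV. Z i)" "finite {i. Z i \<noteq> topspace euclidean}" "(\<Pi>\<^sub>E i\<in>UNIV. Z i) \<subseteq> V"
    using product_topology_open_contains_basis[OF _ assms(2)] by blast
  obtain N where N: "\<And>i. Z i \<noteq> UNIV \<Longrightarrow> i < N"
    using Z(2) by (auto simp: finite_nat_set_iff_bounded)
  show ?thesis
  proof
    fix q' assume a: "agree N q q'"
    have "q' i \<in> Z i" for i
    proof (cases "i < N")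
      case True
      then have "q' i = q i" using a by (simp add: agree_def)
      then show ?thesis using Z(1) by (simp add: PiE_iff)
    next
      case False
      then have "Z i = UNIV" using N by blast
      then show ?thesis by simp
    qed
    then have "q' \<in> (\<Pi>\<^sub>E i\<in>UNIV. Z i)" by (simp add: PiE_iff)
    then show "q' \<in> V" using Z(3) by blast
  qed
qed

lemma continuous_on_agree_iff:
  fixes f :: "cantor \<Rightarrow> cantor"
  shows "continuous_on D f \<longleftrightarrow>
    (\<forall>q\<in>D. \<forall>L. \<exists>N. \<forall>q'\<in>D. agree N q q' \<longrightarrow> agree L (f q) (f q'))"
proof
  assume c: "continuous_on D f"
  show "\<forall>q\<in>D. \<forall>L. \<exists>N. \<forall>q'\<in>D. agree N q q' \<longrightarrow> agree L (f q) (f q')"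
  proof (intro ballI allI)
    fix q L assume "q \<in> D"
    then obtain A where "open A" "q \<in> A" "\<forall>y\<in>D. y \<in> A \<longrightarrow> agree L (f q) (f y)"
      using c[unfolded continuous_on_topological] open_agree[of L "f q"]
      by (metis (no_types, lifting) agree_refl mem_Collect_eq)
    then show "\<exists>N. \<forall>q'\<in>D. agree N q q' \<longrightarrow> agree L (f q) (f q')"
      by (metis open_cantor_agree)
  qed
next
  assume a: "\<forall>q\<in>D. \<forall>L. \<exists>N. \<forall>q'\<in>D. agree N q q' \<longrightarrow> agree L (f q) (f q')"
  show "continuous_on D f"
    unfolding continuous_on_topological
  proof (intro ballI allI impI)
    fix q B assume q: "q \<in> D" "open B" "f q \<in> B"
    then obtain L where L: "\<And>r. agree L (f q) r \<Longrightarrow> r \<in> B" by (metis open_cantor_agree)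
    obtain N where "\<forall>q'\<in>D. agree N q q' \<longrightarrow> agree L (f q) (f q')" using a q by blast
    then show "\<exists>A. open A \<and> q \<in> A \<and> (\<forall>y\<in>D. y \<in> A \<longrightarrow> f y \<in> B)"
      using L open_agree[of N q] by (intro exI[of _ "{q'. agree N q q'}"]) auto
  qed
qed

lemma openin_agree_iff:
  "openin (top_of_set D) {q \<in> D. P q} \<longleftrightarrow>
    (\<forall>q\<in>D. P q \<longrightarrow> (\<exists>N. \<forall>q'\<in>D. agree N q q' \<longrightarrow> P q'))"
proof
  assume "openin (top_of_set D) {q \<in> D. P q}"
  then obtain T where T: "open T" "{q \<in> D. P q} = D \<inter> T" by (auto simp: openin_open)
  show "\<forall>q\<in>D. P q \<longrightarrow> (\<exists>N. \<forall>q'\<in>D. agree N q q' \<longrightarrow> P q')"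
  proof (intro ballI impI)
    fix q assume "q \<in> D" "P q"
    then have "q \<in> T" using T(2) by blast
    then show "\<exists>N. \<forall>q'\<in>D. agree N q q' \<longrightarrow> P q'"
      by (rule open_cantor_agree[OF T(1)]) (use T(2) in blast)
  qed
next
  assume a: "\<forall>q\<in>D. P q \<longrightarrow> (\<exists>N. \<forall>q'\<in>D. agree N q q' \<longrightarrow> P q')"
  define T where "T = \<Union>{{q'. agree N q q'} | N q. \<forall>q'\<in>D. agree N q q' \<longrightarrow> P q'}"
  have "open T" unfolding T_def using open_agree by (intro open_Union) auto
  moreover have "{q \<in> D. P q} = D \<inter> T"
  proof
    show "{q \<in> D. P q} \<subseteq> D \<inter> T"
    proof
      fix q assume "q \<in> {q \<in> D. P q}"
      then obtain N where "\<forall>q'\<in>D. agree N q q' \<longrightarrow> P q'" using a by auto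
      then have "{q'. agree N q q'} \<subseteq> T" unfolding T_def by blast
      then show "q \<in> D \<inter> T" using \<open>q \<in> {q \<in> D. P q}\<close> by auto
    qed
  qed (auto simp: T_def)
  ultimately show "openin (top_of_set D) {q \<in> D. P q}" by (auto simp: openin_open)
qed

text \<open>By some stage \<open>t\<close> the first \<open>L\<close> bits are printed, and the run
  up to \<open>t\<close> sees only \<open>t\<close> cells of each read tape. So \<open>t\<close> is
  a modulus of continuity, jointly in oracle and input.\<close>

lemma otm_fun_local:
  assumes "otm_fun M p q = Some r"
  obtains N where "\<And>p' q' r'. agree N p p' \<Longrightarrow> agree N q q' \<Longrightarrow> otm_fun M p' q' = Some r' \<Longrightarrow> agree L r r'"
proof -
  have "\<exists>t. \<forall>k<L. k < length (cf_out (otm_config M p q t)) \<and> cf_out (otm_config M p q t) ! k = r k"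
  proof (induction L)
    case (Suc L)
    then obtain t where t: "\<forall>k<L. k < length (cf_out (otm_config M p q t)) \<and> cf_out (otm_config M p q t) ! k = r k" by blast
    obtain s where s: "L < length (cf_out (otm_config M p q s))" "cf_out (otm_config M p q s) ! L = r L"
      using assms by (auto simp: otm_fun_eq_Some_iff)
    obtain bs where bs: "cf_out (otm_config M p q (max s t)) = cf_out (otm_config M p q t) @ bs"
      using cf_out_mono[of t "max s t" M p q] by auto
    obtain cs where cs: "cf_out (otm_config M p q (max s t)) = cf_out (otm_config M p q s) @ cs"
      using cf_out_mono[of s "max s t" M p q] by auto
    show ?case
      by (rule exI[of _ "max s t"])
        (metis s t bs cs less_Suc_eq nth_append trans_less_add1 length_append)
  qed simp
  then obtain t where t: "\<And>k. k < L \<Longrightarrow> k < length (cf_out (otm_config M p q t))"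
    "\<And>k. k < L \<Longrightarrow> cf_out (otm_config M p q t) ! k = r k" by blast
  show ?thesis
  proof (rule that[of t])
    fix p' q' r' assume "agree t p p'" "agree t q q'" and r': "otm_fun M p' q' = Some r'"
    then have "otm_config M p q t = otm_config M p' q' t"
      by (intro otm_config_cong) (auto simp: agree_def)
    moreover have "cf_out (otm_config M p' q' s) ! k = r' k"
      if "k < length (cf_out (otm_config M p' q' s))" for k s
      using r' that cf_out_nth_eq unfolding otm_fun_eq_Some_iff by metis
    ultimately show "agree L r r'" using t by (metis agree_def)
  qed
qed

lemma continuous_fun_otm_fun: "continuous_fun (otm_fun M p)"
  unfolding continuous_fun_def continuous_on_agree_iff
proof (intro ballI allI)
  fix q L assume "q \<in> dom (otm_fun M p)"
  then obtain r where r: "otm_fun M p q = Some r" by auto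
  obtain N where "\<And>q' r'. agree N q q' \<Longrightarrow> otm_fun M p q' = Some r' \<Longrightarrow> agree L r r'"
    using otm_fun_local[OF r] agree_refl by metis
  then show "\<exists>N. \<forall>q'\<in>dom (otm_fun M p). agree N q q' \<longrightarrow> agree L (the (otm_fun M p q)) (the (otm_fun M p q'))"
    using r by (intro exI[of _ N]) auto
qed

text \<open>An accepting stage is a finite run, which recurs for all sequences with the same
  prefixes, whether or not they are names.\<close>

lemma accepts_open:
  assumes "accepts w q"
  obtains N where "\<And>w' q'. agree N w w' \<Longrightarrow> agree N q q' \<Longrightarrow> accepts w' q'"
proof -
  obtain s t i where a: "accept_stage w q s t i" using assms by (auto simp: accepts_iff_stage)
  show ?thesis
  proof (rule that)
    fix w' q' assume "agree (Suc (first_one w s + t)) w w'" "agree (Suc (first_one w s + t)) q q'"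
    then show "accepts w' q'"
      using accept_stage_cong[OF a lessI, of w' q'] accepts_iff_stage by (auto simp: agree_def)
  qed
qed

lemma decidable_otm:
  assumes "decidable P"
  obtains m where "\<And>p q. otm_fun (nth_otm m) p q = Some (P p q)"
  using recursive_otm[OF assms[unfolded decidable_def]] by (auto simp: fun_eq_iff)

text \<open>\<open>A p\<close> is the map computed by a total machine, so it is continuous at every
  \<open>q\<close>.\<close>

lemma decidable_local:
  assumes "decidable A"
  obtains N where "\<And>q'. agree N q q' \<Longrightarrow> agree L (A p q) (A p q')"
proof -
  obtain m where m: "\<And>p q. otm_fun (nth_otm m) p q = Some (A p q)"
    using decidable_otm[OF assms] by blast
  show ?thesis using otm_fun_local[OF m[of p q], of L] m that by (metis agree_refl)
qed

section \<open>Semidecidable predicates\<close>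

definition interleave :: "cantor \<Rightarrow> cantor \<Rightarrow> cantor" where
  "interleave p q = (\<lambda>k. if odd k then q (k div 2) else p (k div 2))"

lemma pair_interleave [simp]: "pair_fst (interleave p q) = p" "pair_snd (interleave p q) = q"
  by (auto simp: pair_fst_def pair_snd_def interleave_def)

lemma recursive_div2:
  assumes "recursive f"
  shows "recursive (\<lambda>p q x. f p q x div 2)"
proof -
  let ?F = "\<lambda>z. npair (nsnd z) (Suc (nfst z))"
  have "npair 0 0 = 0" by (simp add: npair_def prod_encode_def)
  then have "(?F ^^ n) 0 = npair (n div 2) (Suc n div 2)" for n by (induction n) auto
  moreover have "recursive (\<lambda>p q x. nfst ((?F ^^ f p q x) 0))"
    by (intro recursive_intros recursive_funpow assms)
  ultimately show ?thesis by simp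
qed

lemma decidable_sequences:
  "decidable (\<lambda>p q. zero_seq)" "decidable (\<lambda>p q. p)" "decidable (\<lambda>p q. q)"
  "decidable A \<Longrightarrow> decidable (\<lambda>p q. pair_fst (A p q))"
  "decidable A \<Longrightarrow> decidable (\<lambda>p q. pair_snd (A p q))"
  "decidable A \<Longrightarrow> decidable B \<Longrightarrow> decidable (\<lambda>p q. interleave (A p q) (B p q))"
  "decidable A \<Longrightarrow> decidable (\<lambda>p q. index_prefix m (A p q))"
proof -
  show "decidable (\<lambda>p q. zero_seq)" unfolding zero_seq_def by (intro recursive_intros)
  show "decidable (\<lambda>p q. p)" "decidable (\<lambda>p q. q)"
    using decidable_read[OF recursive_id] by simp_all
  assume A: "decidable A"
  show "decidable (\<lambda>p q. pair_fst (A p q))" "decidable (\<lambda>p q. pair_snd (A p q))"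
    unfolding pair_fst_def pair_snd_def mult_2
    by (intro decidable_comp[OF A] recursive_intros)+
  show "decidable (\<lambda>p q. index_prefix m (A p q))"
    unfolding index_prefix_def by (intro decidable_comp[OF A] recursive_intros)
  assume B: "decidable B"
  show "decidable (\<lambda>p q. interleave (A p q) (B p q))"
    unfolding interleave_def
    by (intro decidable_comp[OF A] decidable_comp[OF B] recursive_intros recursive_div2)
qed

definition semidecidable :: "(cantor \<Rightarrow> cantor \<Rightarrow> bool) \<Rightarrow> bool" where
  "semidecidable S \<longleftrightarrow> (\<exists>P. decidable P \<and> (\<forall>p q. S p q \<longleftrightarrow> (\<exists>k. P p q k)))"

lemma semidecidable_otm:
  assumes "semidecidable S"
  obtains m where "\<And>p q. \<exists>r. otm_fun (nth_otm m) p q = Some r \<and> (r \<noteq> zero_seq \<longleftrightarrow> S p q)"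
proof -
  obtain P where P: "decidable P" "\<And>p q. S p q \<longleftrightarrow> (\<exists>k. P p q k)"
    using assms by (auto simp: semidecidable_def)
  obtain m where "\<And>p q. otm_fun (nth_otm m) p q = Some (P p q)"
    using decidable_otm[OF P(1)] by blast
  then show ?thesis using P(2) by (intro that) (auto simp: zero_seq_def fun_eq_iff)
qed

lemma ex_npair_iff: "(\<exists>k. P (nfst k) (nsnd k)) \<longleftrightarrow> (\<exists>x y. P x y)"
  by (metis nfst_npair nsnd_npair)

lemma semidecidable_conj:
  assumes "semidecidable S" "semidecidable T"
  shows "semidecidable (\<lambda>p q. S p q \<and> T p q)"
proof -
  obtain P Q where P: "decidable P" "\<And>p q. S p q \<longleftrightarrow> (\<exists>k. P p q k)"
    and Q: "decidable Q" "\<And>p q. T p q \<longleftrightarrow> (\<exists>k. Q p q k)"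
    using assms unfolding semidecidable_def by metis
  have "decidable (\<lambda>p q k. P p q (nfst k) \<and> Q p q (nsnd k))"
    by (intro decidable_comp[OF P(1)] decidable_comp[OF Q(1)] recursive_intros)
  moreover have "S p q \<and> T p q \<longleftrightarrow> (\<exists>k. P p q (nfst k) \<and> Q p q (nsnd k))" for p q
    using ex_npair_iff[of "\<lambda>x y. P p q x \<and> Q p q y"] P(2) Q(2) by auto
  ultimately show ?thesis unfolding semidecidable_def by blast
qed

lemma recursive_seq_const:
  assumes "decidable A"
  shows "recursive_seq (\<lambda>p q _. A p q)"
  unfolding recursive_seq_def by (intro decidable_comp[OF assms] recursive_intros)

lemma semidecidable_accepts:
  assumes "decidable A" "decidable B"
  shows "semidecidable (\<lambda>p q. accepts (A p q) (B p q))"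
proof -
  have "decidable (\<lambda>p q k. accept_stage (A p q) (B p q) (nfst k) (nfst (nsnd k)) (nsnd (nsnd k)))"
    by (intro decidable_accept_stage recursive_seq_const recursive_intros assms)
  moreover have "accepts w r \<longleftrightarrow> (\<exists>k. accept_stage w r (nfst k) (nfst (nsnd k)) (nsnd (nsnd k)))" for w r
    unfolding accepts_iff_stage using ex_npair_iff[of "accept_stage w r _"]
      ex_npair_iff[of "\<lambda>s j. accept_stage w r s (nfst j) (nsnd j)"] by auto
  ultimately show ?thesis unfolding semidecidable_def by blast
qed

text \<open>
  Acceptance by a name that is itself the output of a machine: a finite part of that output
  suffices as long as the simulated computation is shorter than the oracle prefix available.
\<close>

lemma semidecidable_accepts_output:
  assumes "decidable A" "decidable B"
  obtains S where "semidecidable S"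
    "\<And>p q w. otm_fun (nth_otm n) zero_seq (A p q) = Some w \<Longrightarrow> S p q \<longleftrightarrow> accepts w (B p q)"
proof -
  \<comment> \<open>The output after \<open>u\<close> steps, padded with zeros. The length guard in
    \<open>R\<close> keeps the padding out of reach of the accepting stage.\<close>
  define V where "V = (\<lambda>p q u. output_true n zero_seq (A p q) u)"
  define R where "R = (\<lambda>p q u s t i. first_one (V p q u) s + t < length (output_at n zero_seq (A p q) u)
    \<and> accept_stage (V p q u) (B p q) s t i)"
  define S where "S = (\<lambda>p q. \<exists>u s t i. R p q u s t i)"
  have V: "recursive_seq (\<lambda>p q k. V p q (nfst k))"
    unfolding recursive_seq_def V_def
    by (intro decidable_output_true recursive_seq_const decidable_sequences recursive_intros assms)
  have "decidable (\<lambda>p q k. R p q (nfst k) (nfst (nsnd k)) (nfst (nsnd (nsnd k))) (nsnd (nsnd (nsnd k))))"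
    unfolding R_def
    by (intro decidable_accept_stage recursive_first_one V recursive_length_output recursive_seq_const
        recursive_intros decidable_sequences assms)
  moreover have "S p q \<longleftrightarrow> (\<exists>k. R p q (nfst k) (nfst (nsnd k)) (nfst (nsnd (nsnd k))) (nsnd (nsnd (nsnd k))))" for p q
  proof
    assume "S p q"
    then obtain u s t i where "R p q u s t i" by (auto simp: S_def)
    then show "\<exists>k. R p q (nfst k) (nfst (nsnd k)) (nfst (nsnd (nsnd k))) (nsnd (nsnd (nsnd k)))"
      by (intro exI[of _ "npair u (npair s (npair t i))"]) simp
  qed (auto simp: S_def)
  ultimately have "semidecidable S" unfolding semidecidable_def by blast
  moreover have "S p q \<longleftrightarrow> accepts w (B p q)" if w: "otm_fun (nth_otm n) zero_seq (A p q) = Some w" for p q w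
  proof -
    let ?len = "\<lambda>u. length (output_at n zero_seq (A p q) u)"
    have V_w: "V p q u k = w k" if "k < ?len u" for k u
    proof -
      obtain u' where "k < ?len u'" "output_at n zero_seq (A p q) u' ! k = w k"
        using w by (auto simp: otm_fun_eq_Some_iff)
      with that show ?thesis unfolding V_def output_true_def using cf_out_nth_eq by metis
    qed
    show ?thesis
    proof
      assume "S p q"
      then obtain u s t i where "first_one (V p q u) s + t < ?len u" "accept_stage (V p q u) (B p q) s t i"
        by (auto simp: S_def R_def)
      then show "accepts w (B p q)"
        using accept_stage_cong V_w accepts_iff_stage by metis
    next
      assume "accepts w (B p q)"
      then obtain s t i where a: "accept_stage w (B p q) s t i" by (auto simp: accepts_iff_stage)
      obtain u where u: "first_one w s + t < ?len u"
        using w unfolding otm_fun_eq_Some_iff by blast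
      have "accept_stage (V p q u) (B p q) s t i"
        by (rule accept_stage_cong[OF a u]) (auto simp: V_w)
      moreover have "first_one (V p q u) s = first_one w s"
        by (rule first_one_cong[of _ _ "?len u"]) (use u in \<open>auto simp: V_w\<close>)
      ultimately show "S p q" using u unfolding S_def R_def by metis
    qed
  qed
  ultimately show ?thesis using that by blast
qed

section \<open>Open and overt sets\<close>

lemma points_iff: "x \<in> points X \<longleftrightarrow> (\<exists>q. X q = Some x)"
  by (auto simp: points_def ran_def)

lemma prod_space_eq_Some_iff:
  "prod_space X Y r = Some (x, y) \<longleftrightarrow> X (pair_fst r) = Some x \<and> Y (pair_snd r) = Some y"
  by (auto simp: prod_space_def split: option.split)

lemma points_prod_space: "points (prod_space X Y) = points X \<times> points Y"
proof -
  have "(x, y) \<in> points (prod_space X Y)" if "X p = Some x" "Y q = Some y" for x y p q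
    unfolding points_iff using that
    by (intro exI[of _ "interleave p q"]) (simp add: prod_space_eq_Some_iff)
  then show ?thesis by (auto simp: points_iff prod_space_eq_Some_iff)
qed

lemma realizes_points: "realizes X Y F f \<Longrightarrow> f \<in> points X \<rightarrow> points Y"
  by (fastforce simp: realizes_def points_iff)

lemma rep_continuous_iff: "rep_continuous X Y f \<longleftrightarrow> (\<exists>F. continuous_fun F \<and> realizes X Y F f)"
  unfolding rep_continuous_def using realizes_points by blast

lemma rep_computable_iff: "rep_computable X Y f \<longleftrightarrow> (\<exists>F. computable_fun F \<and> realizes X Y F f)"
  unfolding rep_computable_def using realizes_points by blast

lemma open_space_eq_Some_iff:
  "open_space X w = Some U \<longleftrightarrow> U \<subseteq> points X \<and> (\<exists>n p. w = index_prefix n p \<and>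
     (\<forall>q x. X q = Some x \<longrightarrow>
       (\<exists>r. otm_fun (nth_otm n) p q = Some r \<and> (r \<noteq> zero_seq \<longleftrightarrow> x \<in> U))))"
  (is "_ \<longleftrightarrow> ?R")
proof
  assume "open_space X w = Some U"
  then obtain f where f: "names_map X sierpinski w f" "U = {x \<in> points X. f x}"
    by (auto simp: open_space_def map_space_eq_Some_iff)
  then show ?R
    unfolding names_map_def realizes_def sierpinski_def
    by (auto simp: points_iff) (metis option.inject)
next
  assume R: ?R
  let ?f = "\<lambda>x\<in>points X. x \<in> U"
  have "points sierpinski = UNIV"
    unfolding points_def ran_def sierpinski_def
    by (auto simp: zero_seq_def fun_eq_iff)
  then have "names_map X sierpinski w ?f"
    using R unfolding names_map_def realizes_def sierpinski_def
    by (auto simp: points_iff) metis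
  moreover have "U = {x \<in> points X. ?f x}" using R by auto
  ultimately show "open_space X w = Some U"
    by (auto simp: open_space_def map_space_eq_Some_iff[symmetric])
qed

text \<open>Reads a name of an open set whatever its index and oracle. With
  \<open>open_space X\<close> in place of \<open>X\<close> it applies to names of overt sets
  too.\<close>

lemma open_space_accepts:
  assumes "open_space X w = Some U" "X q = Some x"
  shows "accepts w q \<longleftrightarrow> x \<in> U"
proof -
  obtain n p r where "w = index_prefix n p" "otm_fun (nth_otm n) p q = Some r"
    "r \<noteq> zero_seq \<longleftrightarrow> x \<in> U"
    using assms unfolding open_space_eq_Some_iff by blast
  then show ?thesis using accepts_otm_fun by blast
qed

lemma open_spaceI:
  assumes "\<And>p q. \<exists>r. otm_fun (nth_otm m) p q = Some r \<and> (r \<noteq> zero_seq \<longleftrightarrow> S p q)"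
    and "U \<subseteq> points X" "\<And>q x. X q = Some x \<Longrightarrow> S p q \<longleftrightarrow> x \<in> U"
  shows "open_space X (index_prefix m p) = Some U"
  unfolding open_space_eq_Some_iff using assms by metis

section \<open>Prefix codes and the quotient topology\<close>

text \<open>The length is stored beside the bits: it tells the iteration which bit comes next and
  keeps prefixes of different lengths from sharing a code.\<close>

definition prefix_code :: "cantor \<Rightarrow> nat \<Rightarrow> nat" where
  "prefix_code q j = ((\<lambda>z. npair (Suc (nfst z)) (npair (of_bool (q (nfst z))) (nsnd z))) ^^ j) 0"

lemma nfst_prefix_code: "nfst (prefix_code q j) = j"
  by (induction j) (auto simp: prefix_code_def)

lemma prefix_code_Suc:
  "prefix_code q (Suc j) = npair (Suc j) (npair (of_bool (q j)) (nsnd (prefix_code q j)))"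
  using nfst_prefix_code[of q j] by (simp add: prefix_code_def)

lemma agree_prefix_code: "prefix_code q N = prefix_code q' N \<Longrightarrow> agree N q q'"
proof (induction N)
  case (Suc N)
  have "npair (nfst z) (nsnd z) = z" for z by (simp add: npair_def nfst_def nsnd_def)
  then have "prefix_code q N = prefix_code q' N"
    using Suc.prems nfst_prefix_code unfolding prefix_code_Suc by (metis nfst_npair nsnd_npair)
  moreover have "q N = q' N" using Suc.prems by (auto simp: prefix_code_Suc of_bool_eq_iff)
  ultimately show ?case using Suc.IH by (auto simp: agree_def less_Suc_eq)
qed (simp add: agree_def)

text \<open>An open set is named by an oracle that lists the codes of prefixes contained in it.\<close>

lemma points_open_space: "U \<in> points (open_space X) \<longleftrightarrow> openin (rep_topology X) U"
proof
  assume "U \<in> points (open_space X)"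
  then obtain w where w: "open_space X w = Some U" by (auto simp: points_iff)
  have "\<exists>N. \<forall>q'\<in>dom X. agree N q q' \<longrightarrow> the (X q') \<in> U" if q: "q \<in> dom X" "the (X q) \<in> U" for q
  proof -
    have "accepts w q" using q open_space_accepts[OF w] by auto
    then obtain N where "\<And>w' q'. agree N w w' \<Longrightarrow> agree N q q' \<Longrightarrow> accepts w' q'"
      by (rule accepts_open) blast
    then show ?thesis using open_space_accepts[OF w] agree_refl by (metis domD option.sel)
  qed
  moreover have "U \<subseteq> points X" using w by (simp add: open_space_eq_Some_iff)
  ultimately show "openin (rep_topology X) U"
    by (simp add: openin_rep_topology openin_agree_iff)
next
  assume "openin (rep_topology X) U"
  then have U: "U \<subseteq> points X"
    and loc: "\<And>q. q \<in> dom X \<Longrightarrow> the (X q) \<in> U \<Longrightarrow> \<exists>N. \<forall>q'\<in>dom X. agree N q q' \<longrightarrow> the (X q') \<in> U"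
    by (auto simp: openin_rep_topology openin_agree_iff)
  \<comment> \<open>Prefixes that extend to no name are listed too. This is harmless, because the
    list is only consulted along names \<open>q\<close>, and a name that agrees with a listed prefix
    is itself covered by the condition.\<close>
  define p where "p = (\<lambda>c. \<exists>q N. c = prefix_code q N \<and> (\<forall>q'\<in>dom X. agree N q q' \<longrightarrow> the (X q') \<in> U))"
  have "decidable (\<lambda>p q k. p (prefix_code q k))"
    unfolding prefix_code_def by (intro recursive_intros recursive_funpow)
  then have "semidecidable (\<lambda>p q. \<exists>k. p (prefix_code q k))"
    unfolding semidecidable_def by blast
  then obtain m where m: "\<And>p q. \<exists>r. otm_fun (nth_otm m) p q = Some r \<and>
      (r \<noteq> zero_seq \<longleftrightarrow> (\<exists>k. p (prefix_code q k)))"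
    by (rule semidecidable_otm) blast
  have "(\<exists>k. p (prefix_code q k)) \<longleftrightarrow> x \<in> U" if x: "X q = Some x" for q x
  proof
    assume "\<exists>k. p (prefix_code q k)"
    then obtain k q' N where c: "prefix_code q k = prefix_code q' N"
      and q': "\<forall>q''\<in>dom X. agree N q' q'' \<longrightarrow> the (X q'') \<in> U" by (auto simp: p_def)
    then have "k = N" by (metis nfst_prefix_code)
    then have "agree N q' q" using c agree_prefix_code by metis
    then show "x \<in> U" using q' x by fastforce
  next
    assume "x \<in> U"
    then show "\<exists>k. p (prefix_code q k)" using loc[of q] x unfolding p_def by fastforce
  qed
  then have "open_space X (index_prefix m p) = Some U" by (intro open_spaceI[OF m U])
  then show "U \<in> points (open_space X)" by (auto simp: points_iff)
qed

lemma opens_meeting_subset: "opens_meeting X A \<subseteq> points (open_space X)"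
  by (auto simp: opens_meeting_def)

text \<open>The closure depends on \<open>A\<close> only through \<open>opens_meeting X A\<close>,
  which makes the naming relation of \<open>overt_space\<close> single-valued.\<close>

lemma closure_of_eq_opens_meeting:
  "rep_topology X closure_of A = {x \<in> points X. \<forall>T\<in>points (open_space X). x \<in> T \<longrightarrow> T \<in> opens_meeting X A}"
  unfolding closure_of_def opens_meeting_def points_open_space[symmetric] topspace_rep_topology by auto

lemma represented_by_eq_Some_iff:
  assumes "\<And>x y. N p x \<Longrightarrow> N p y \<Longrightarrow> y = x"
  shows "represented_by N p = Some x \<longleftrightarrow> N p x"
proof (cases "\<exists>x. N p x")
  case True
  then have "\<exists>!x. N p x" using assms by blast
  then show ?thesis using theI'[of "N p"] assms by (auto simp: represented_by_def)
next
  case False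
  then show ?thesis by (auto simp: represented_by_def)
qed

lemma overt_space_eq_Some_iff:
  "overt_space X r = Some C \<longleftrightarrow> (\<exists>A\<subseteq>points X. C = rep_topology X closure_of A \<and>
     open_space (open_space X) r = Some (opens_meeting X A))"
  (is "_ \<longleftrightarrow> ?N C")
proof -
  have uniq: "D = C" if C: "?N C" and D: "?N D" for C D
  proof -
    obtain A where A: "C = rep_topology X closure_of A"
      "open_space (open_space X) r = Some (opens_meeting X A)" using C by blast
    obtain B where B: "D = rep_topology X closure_of B"
      "open_space (open_space X) r = Some (opens_meeting X B)" using D by blast
    have "opens_meeting X A = opens_meeting X B" using A(2) B(2) by simp
    then show ?thesis unfolding A(1) B(1) closure_of_eq_opens_meeting by simp
  qed
  show ?thesis
    unfolding overt_space_def by (rule represented_by_eq_Some_iff) (rule uniq)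
qed

section \<open>Deciding equality\<close>

definition decides_eq :: "'a rep_space \<Rightarrow> nat \<Rightarrow> cantor \<Rightarrow> bool" where
  "decides_eq X n p \<longleftrightarrow> (\<forall>r x y. prod_space X X r = Some (x, y) \<longrightarrow>
     (\<exists>s. otm_fun (nth_otm n) p r = Some s \<and> (s \<noteq> zero_seq \<longleftrightarrow> x = y)))"

lemma open_space_diagonal_iff:
  "open_space (prod_space X X) w = Some (diagonal X) \<longleftrightarrow> (\<exists>n p. w = index_prefix n p \<and> decides_eq X n p)"
proof -
  have "diagonal X \<subseteq> points (prod_space X X)" by (auto simp: points_prod_space diagonal_def)
  moreover have "(x, y) \<in> diagonal X \<longleftrightarrow> x = y" if "prod_space X X r = Some (x, y)" for x y r
    using that by (auto simp: diagonal_def prod_space_eq_Some_iff points_iff)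
  ultimately show ?thesis
    unfolding open_space_eq_Some_iff decides_eq_def by auto
qed

lemma diagonal_open_iff: "diagonal X \<in> points (open_space (prod_space X X)) \<longleftrightarrow> (\<exists>n p. decides_eq X n p)"
  unfolding points_iff open_space_diagonal_iff by blast

lemma realizes_eq_iff:
  "realizes (prod_space X X) sierpinski F (\<lambda>(x, y). x = y) \<longleftrightarrow>
     (\<forall>r x y. prod_space X X r = Some (x, y) \<longrightarrow> (\<exists>s. F r = Some s \<and> (s \<noteq> zero_seq \<longleftrightarrow> x = y)))"
  unfolding realizes_def sierpinski_def by auto

lemma computable_eq_iff:
  "rep_computable (prod_space X X) sierpinski (\<lambda>(x, y). x = y) \<longleftrightarrow> (\<exists>n. decides_eq X n zero_seq)"
proof -
  have "(\<exists>F. computable_fun F \<and> Q F) \<longleftrightarrow> (\<exists>n. Q (otm_fun (nth_otm n) zero_seq))" for Q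
    by (auto simp: computable_fun_def)
  then show ?thesis
    by (simp only: rep_computable_iff realizes_eq_iff decides_eq_def)
qed

text \<open>The hypothesis is openness of the diagonal, tested at names of its points. The detour
  through \<open>points_open_space\<close> is what supplies an index and an oracle in the continuous
  case.\<close>

lemma decides_eq_if_local:
  assumes "\<And>r x. prod_space X X r = Some (x, x) \<Longrightarrow>
    \<exists>N. \<forall>r' x' y'. agree N r r' \<longrightarrow> prod_space X X r' = Some (x', y') \<longrightarrow> x' = y'"
  shows "\<exists>n p. decides_eq X n p"
proof -
  have "\<exists>N. \<forall>r'\<in>dom (prod_space X X). agree N r r' \<longrightarrow> the (prod_space X X r') \<in> diagonal X"
    if r: "r \<in> dom (prod_space X X)" "the (prod_space X X r) \<in> diagonal X" for r
  proof -
    obtain x where "prod_space X X r = Some (x, x)" using r by (auto simp: diagonal_def)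
    from assms[OF this] obtain N where
      N: "\<And>r' x' y'. agree N r r' \<Longrightarrow> prod_space X X r' = Some (x', y') \<Longrightarrow> x' = y'" by blast
    have "the (prod_space X X r') \<in> diagonal X" if r': "r' \<in> dom (prod_space X X)" "agree N r r'" for r'
    proof -
      obtain z where z: "prod_space X X r' = Some z" using r'(1) by auto
      obtain x' y' where xy: "z = (x', y')" by (cases z)
      have "x' = y'" using N[OF r'(2)] z xy by blast
      moreover have "x' \<in> points X"
        using z xy by (auto simp: prod_space_eq_Some_iff points_iff)
      ultimately show ?thesis using z xy by (auto simp: diagonal_def)
    qed
    then show ?thesis by blast
  qed
  moreover have "diagonal X \<subseteq> points (prod_space X X)" by (auto simp: points_prod_space diagonal_def)
  ultimately have "openin (rep_topology (prod_space X X)) (diagonal X)"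
    by (simp add: openin_rep_topology openin_agree_iff)
  then show ?thesis by (simp add: points_open_space[symmetric] diagonal_open_iff)
qed

lemma continuous_eq_iff:
  "rep_continuous (prod_space X X) sierpinski (\<lambda>(x, y). x = y) \<longleftrightarrow> (\<exists>n p. decides_eq X n p)"
proof
  assume "rep_continuous (prod_space X X) sierpinski (\<lambda>(x, y). x = y)"
  then obtain F where c: "continuous_fun F"
    and F: "\<And>r x y. prod_space X X r = Some (x, y) \<Longrightarrow> \<exists>s. F r = Some s \<and> (s \<noteq> zero_seq \<longleftrightarrow> x = y)"
    unfolding rep_continuous_iff realizes_eq_iff by blast
  show "\<exists>n p. decides_eq X n p"
  proof (rule decides_eq_if_local)
    fix r x assume "prod_space X X r = Some (x, x)"
    then obtain s where s: "F r = Some s" "s \<noteq> zero_seq" using F by blast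
    \<comment> \<open>A single \<open>1\<close> certifies equality, and continuity preserves its
      position \<open>k\<close> on a neighbourhood.\<close>
    then obtain k where k: "s k" by (auto simp: zero_seq_def fun_eq_iff)
    obtain N where N: "\<forall>r'\<in>dom F. agree N r r' \<longrightarrow> agree (Suc k) (the (F r)) (the (F r'))"
      using c s unfolding continuous_fun_def continuous_on_agree_iff by blast
    have "x' = y'" if r': "agree N r r'" "prod_space X X r' = Some (x', y')" for r' x' y'
    proof -
      obtain s' where s': "F r' = Some s'" "s' \<noteq> zero_seq \<longleftrightarrow> x' = y'" using F[OF r'(2)] by blast
      then have "s' k" using N r' s k by (force simp: agree_def)
      then show ?thesis using s' by (auto simp: zero_seq_def)
    qed
    then show "\<exists>N. \<forall>r' x' y'. agree N r r' \<longrightarrow> prod_space X X r' = Some (x', y') \<longrightarrow> x' = y'" by blast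
  qed
next
  assume "\<exists>n p. decides_eq X n p"
  then show "rep_continuous (prod_space X X) sierpinski (\<lambda>(x, y). x = y)"
    unfolding rep_continuous_iff realizes_eq_iff decides_eq_def using continuous_fun_otm_fun by blast
qed

text \<open>Each of the conditions on \<open>X\<close> provides a realizer \<open>F\<close> from which equality is read off this way.\<close>

definition yields_eq ::
    "'a rep_space \<Rightarrow> (cantor \<Rightarrow> cantor option) \<Rightarrow> (cantor \<Rightarrow> cantor) \<Rightarrow> (cantor \<Rightarrow> cantor) \<Rightarrow> bool" where
  "yields_eq X F \<alpha> \<beta> \<longleftrightarrow> (\<forall>r x y. prod_space X X r = Some (x, y) \<longrightarrow>
     (\<exists>w. F (\<alpha> r) = Some w \<and> (accepts w (\<beta> r) \<longleftrightarrow> x = y)))"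

text \<open>The name \<open>w\<close> exists only as output of the machine for \<open>F\<close>, so
  acceptance is searched along its finite outputs.\<close>

lemma yields_eq_computable:
  assumes "yields_eq X F \<alpha> \<beta>" "computable_fun F" "decidable (\<lambda>_. \<alpha>)" "decidable (\<lambda>_. \<beta>)"
  shows "\<exists>n. decides_eq X n zero_seq"
proof -
  obtain n where n: "F = otm_fun (nth_otm n) zero_seq"
    using assms(2) by (auto simp: computable_fun_def)
  obtain S where S: "semidecidable S"
    "\<And>p q w. otm_fun (nth_otm n) zero_seq (\<alpha> q) = Some w \<Longrightarrow> S p q \<longleftrightarrow> accepts w (\<beta> q)"
    using semidecidable_accepts_output[OF assms(3,4), of n] by blast
  obtain m where m: "\<And>p q. \<exists>r. otm_fun (nth_otm m) p q = Some r \<and> (r \<noteq> zero_seq \<longleftrightarrow> S p q)"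
    using semidecidable_otm[OF S(1)] by blast
  have "decides_eq X m zero_seq"
    unfolding decides_eq_def
  proof (intro allI impI)
    fix r x y assume "prod_space X X r = Some (x, y)"
    then obtain w where "F (\<alpha> r) = Some w" "accepts w (\<beta> r) \<longleftrightarrow> x = y"
      using assms(1) unfolding yields_eq_def by blast
    then show "\<exists>s. otm_fun (nth_otm m) zero_seq r = Some s \<and> (s \<noteq> zero_seq \<longleftrightarrow> x = y)"
      using S(2) m[of zero_seq r] unfolding n by blast
  qed
  then show ?thesis ..
qed

text \<open>Acceptance is open, \<open>F\<close> is continuous on its domain and
  \<open>\<alpha>\<close>, \<open>\<beta>\<close> are continuous. So acceptance, and with it
  equality, persists near every name of a diagonal point.\<close>

lemma yields_eq_continuous:
  assumes "yields_eq X F \<alpha> \<beta>" "continuous_fun F" "decidable (\<lambda>_. \<alpha>)" "decidable (\<lambda>_. \<beta>)"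
  shows "\<exists>n p. decides_eq X n p"
proof (rule decides_eq_if_local)
  fix r x assume "prod_space X X r = Some (x, x)"
  then obtain w where w: "F (\<alpha> r) = Some w" "accepts w (\<beta> r)"
    using assms(1) unfolding yields_eq_def by blast
  obtain N where N: "\<And>w' q'. agree N w w' \<Longrightarrow> agree N (\<beta> r) q' \<Longrightarrow> accepts w' q'"
    using accepts_open[OF w(2)] by blast
  obtain L where L: "\<forall>q'\<in>dom F. agree L (\<alpha> r) q' \<longrightarrow> agree N (the (F (\<alpha> r))) (the (F q'))"
    using assms(2) w(1) unfolding continuous_fun_def continuous_on_agree_iff by blast
  obtain K1 where K1: "\<And>r'. agree K1 r r' \<Longrightarrow> agree L (\<alpha> r) (\<alpha> r')"
    using decidable_local[OF assms(3)] by metis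
  obtain K2 where K2: "\<And>r'. agree K2 r r' \<Longrightarrow> agree N (\<beta> r) (\<beta> r')"
    using decidable_local[OF assms(4)] by metis
  have "x' = y'" if r': "agree (max K1 K2) r r'" "prod_space X X r' = Some (x', y')" for r' x' y'
  proof -
    obtain w' where w': "F (\<alpha> r') = Some w'" "accepts w' (\<beta> r') \<longleftrightarrow> x' = y'"
      using assms(1) r'(2) unfolding yields_eq_def by blast
    have "agree K1 r r'" "agree K2 r r'" using r'(1) by (auto elim: agree_mono)
    then have "agree N w w'" using L K1 w w' by (metis domI option.sel)
    then show ?thesis using N K2 \<open>agree K2 r r'\<close> w'(2) by blast
  qed
  then show "\<exists>N. \<forall>r' x' y'. agree N r r' \<longrightarrow> prod_space X X r' = Some (x', y') \<longrightarrow> x' = y'" by blast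
qed

section \<open>Realizers obtained from equality\<close>

text \<open>Currying on names: the argument is only packed into the oracle beside \<open>p\<close>,
  and all work is left to machine \<open>m\<close>.\<close>

lemma index_prefix_interleave:
  "continuous_fun (\<lambda>q. Some (index_prefix m (interleave p q)))"
  "computable_fun (\<lambda>q. Some (index_prefix m (interleave zero_seq q)))"
proof -
  have "decidable (\<lambda>p q. index_prefix m (interleave p q))" by (intro decidable_sequences)
  then obtain n where n: "\<And>p q. otm_fun (nth_otm n) p q = Some (index_prefix m (interleave p q))"
    by (rule decidable_otm) blast
  have "otm_fun (nth_otm n) p = (\<lambda>q. Some (index_prefix m (interleave p q)))" for p
    using n by (intro ext)
  then show "continuous_fun (\<lambda>q. Some (index_prefix m (interleave p q)))"
    "computable_fun (\<lambda>q. Some (index_prefix m (interleave zero_seq q)))"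
    using continuous_fun_otm_fun[of "nth_otm n" p] unfolding computable_fun_def by metis+
qed

text \<open>The equality test is curried: the oracle holds \<open>p\<close> and the name
  \<open>q\<close> of \<open>x\<close>, the input is a name of the candidate point, and index
  \<open>n\<close> is simulated on the pair.\<close>

lemma decides_eq_singleton:
  assumes "decides_eq X n p"
  obtains m where "\<And>q x. X q = Some x \<Longrightarrow> open_space X (index_prefix m (interleave p q)) = Some {x}"
proof -
  have "semidecidable (\<lambda>P Q. accepts (index_prefix n (pair_fst P)) (interleave (pair_snd P) Q))"
    by (intro semidecidable_accepts decidable_sequences)
  then obtain m where m: "\<And>P Q. \<exists>r. otm_fun (nth_otm m) P Q = Some r \<and>
      (r \<noteq> zero_seq \<longleftrightarrow> accepts (index_prefix n (pair_fst P)) (interleave (pair_snd P) Q))"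
    by (rule semidecidable_otm) blast
  have eq: "accepts (index_prefix n p) (interleave q q') \<longleftrightarrow> y \<in> {x}"
    if "X q = Some x" "X q' = Some y" for q q' x y
  proof -
    have "prod_space X X (interleave q q') = Some (x, y)"
      using that by (simp add: prod_space_eq_Some_iff)
    then obtain s where "otm_fun (nth_otm n) p (interleave q q') = Some s" "s \<noteq> zero_seq \<longleftrightarrow> x = y"
      using assms unfolding decides_eq_def by blast
    then show ?thesis using accepts_otm_fun by auto
  qed
  show ?thesis
    by (rule that, rule open_spaceI[OF m]) (auto simp: points_iff eq)
qed

text \<open>Every subset is a union of open singletons, hence also closed. This removes closures
  from the names of overt sets.\<close>

lemma decides_eq_openin:
  assumes "decides_eq X n p" "A \<subseteq> points X"
  shows "openin (rep_topology X) A"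
proof -
  obtain m where m: "\<And>q x. X q = Some x \<Longrightarrow> open_space X (index_prefix m (interleave p q)) = Some {x}"
    using decides_eq_singleton[OF assms(1)] by blast
  have "openin (rep_topology X) {x}" if "x \<in> A" for x
    using that assms(2) m unfolding points_open_space[symmetric] points_iff[of "{x}"] by (metis points_iff subsetD)
  then have "openin (rep_topology X) (\<Union>x\<in>A. {x})" by (intro openin_Union) auto
  then show ?thesis by simp
qed

lemma decides_eq_closure_of:
  assumes "decides_eq X n p" "A \<subseteq> points X"
  shows "rep_topology X closure_of A = A"
  using decides_eq_openin[OF assms(1), of "points X - A"] assms(2)
  by (simp add: closure_of_eq closedin_def topspace_rep_topology)

lemma decides_eq_t1: "decides_eq X n p \<Longrightarrow> t1_space (rep_topology X)"
  unfolding t1_space_def topspace_rep_topology using decides_eq_openin[of X n p "{_}"]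
  by (metis empty_subsetI insert_subset singletonD singletonI)

lemma decides_eq_overt_space:
  assumes "decides_eq X n p"
  shows "overt_space X r = Some A \<longleftrightarrow> A \<subseteq> points X \<and> open_space (open_space X) r = Some (opens_meeting X A)"
proof
  assume "overt_space X r = Some A"
  then obtain B where B: "B \<subseteq> points X" "A = rep_topology X closure_of B"
    "open_space (open_space X) r = Some (opens_meeting X B)"
    unfolding overt_space_eq_Some_iff by blast
  have "A = B" using decides_eq_closure_of[OF assms B(1)] B(2) by simp
  with B show "A \<subseteq> points X \<and> open_space (open_space X) r = Some (opens_meeting X A)" by simp
next
  assume A: "A \<subseteq> points X \<and> open_space (open_space X) r = Some (opens_meeting X A)"
  then have "rep_topology X closure_of A = A" by (simp add: decides_eq_closure_of[OF assms])
  with A show "overt_space X r = Some A"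
    unfolding overt_space_eq_Some_iff by (intro exI[of _ A]) simp
qed

lemma decides_eq_realizes_singleton:
  assumes "decides_eq X n p"
  obtains m where "realizes X (open_space X) (\<lambda>q. Some (index_prefix m (interleave p q))) (\<lambda>x. {x})"
  using decides_eq_singleton[OF assms] unfolding realizes_def by (metis (no_types, lifting))

text \<open>\<open>x\<close> lies in \<open>A\<close> iff the open set \<open>{x}\<close> meets
  \<open>A\<close>, so the overt name is asked about the name of \<open>{x}\<close> computed from
  that of \<open>x\<close>.\<close>

lemma decides_eq_realizes_id:
  assumes "decides_eq X n p"
  obtains m where "realizes (overt_space X) (open_space X) (\<lambda>q. Some (index_prefix m (interleave p q))) id"
proof -
  obtain k where k: "\<And>q x. X q = Some x \<Longrightarrow> open_space X (index_prefix k (interleave p q)) = Some {x}"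
    using decides_eq_singleton[OF assms] by blast
  have "semidecidable (\<lambda>P Q. accepts (pair_snd P) (index_prefix k (interleave (pair_fst P) Q)))"
    by (intro semidecidable_accepts decidable_sequences)
  then obtain m where m: "\<And>P Q. \<exists>r. otm_fun (nth_otm m) P Q = Some r \<and>
      (r \<noteq> zero_seq \<longleftrightarrow> accepts (pair_snd P) (index_prefix k (interleave (pair_fst P) Q)))"
    by (rule semidecidable_otm) blast
  have "open_space X (index_prefix m (interleave p r)) = Some A" if "overt_space X r = Some A" for r A
  proof -
    have A: "A \<subseteq> points X" "open_space (open_space X) r = Some (opens_meeting X A)"
      using that decides_eq_overt_space[OF assms] by auto
    have "accepts r (index_prefix k (interleave p q)) \<longleftrightarrow> x \<in> A" if x: "X q = Some x" for q x
      using open_space_accepts[OF A(2) k[OF x]] k[OF x] by (auto simp: opens_meeting_def points_iff)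
    then show ?thesis by (intro open_spaceI[OF m A(1)]) simp
  qed
  then show ?thesis by (intro that) (auto simp: realizes_def)
qed

text \<open>\<open>A \<inter> B\<close> meets \<open>U\<close> iff \<open>A\<close> meets the open set \<open>U \<inter> B\<close>, and \<open>x \<in> B\<close> iff \<open>B\<close> meets \<open>{x}\<close>.\<close>

lemma decides_eq_realizes_inter:
  assumes "decides_eq X n p"
  obtains m where "realizes (prod_space (overt_space X) (overt_space X)) (overt_space X)
    (\<lambda>q. Some (index_prefix m (interleave p q))) (\<lambda>(A, B). A \<inter> B)"
proof -
  obtain k where k: "\<And>q x. X q = Some x \<Longrightarrow> open_space X (index_prefix k (interleave p q)) = Some {x}"
    using decides_eq_singleton[OF assms] by blast
  \<comment> \<open>Machine \<open>l\<close> names \<open>U \<inter> B\<close>: \<open>P\<close>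
    holds \<open>p\<close>, an overt name of \<open>B\<close> and a name of \<open>U\<close>;
    \<open>Q\<close> names a point.\<close>
  have "semidecidable (\<lambda>P Q. accepts (pair_snd (pair_snd P)) Q \<and>
      accepts (pair_fst (pair_snd P)) (index_prefix k (interleave (pair_fst P) Q)))"
    by (intro semidecidable_conj semidecidable_accepts decidable_sequences)
  then obtain l where l: "\<And>P Q. \<exists>r. otm_fun (nth_otm l) P Q = Some r \<and>
      (r \<noteq> zero_seq \<longleftrightarrow> accepts (pair_snd (pair_snd P)) Q \<and>
      accepts (pair_fst (pair_snd P)) (index_prefix k (interleave (pair_fst P) Q)))"
    by (rule semidecidable_otm) blast
  \<comment> \<open>Machine \<open>m\<close> names the opens meeting \<open>A \<inter> B\<close>:
    \<open>P\<close> holds \<open>p\<close> and the names of \<open>A\<close> and \<open>B\<close>,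
    \<open>Q\<close> names \<open>U\<close>, and \<open>A\<close> is asked about
    \<open>U \<inter> B\<close>.\<close>
  have "semidecidable (\<lambda>P Q. accepts (pair_fst (pair_snd P))
      (index_prefix l (interleave (pair_fst P) (interleave (pair_snd (pair_snd P)) Q))))"
    by (intro semidecidable_accepts decidable_sequences)
  then obtain m where m: "\<And>P Q. \<exists>r. otm_fun (nth_otm m) P Q = Some r \<and>
      (r \<noteq> zero_seq \<longleftrightarrow> accepts (pair_fst (pair_snd P))
        (index_prefix l (interleave (pair_fst P) (interleave (pair_snd (pair_snd P)) Q))))"
    by (rule semidecidable_otm) blast
  have "overt_space X (index_prefix m (interleave p r)) = Some (A \<inter> B)"
    if r: "prod_space (overt_space X) (overt_space X) r = Some (A, B)" for r A B
  proof -
    have A: "A \<subseteq> points X" "open_space (open_space X) (pair_fst r) = Some (opens_meeting X A)"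
      and B: "B \<subseteq> points X" "open_space (open_space X) (pair_snd r) = Some (opens_meeting X B)"
      using r by (auto simp: prod_space_eq_Some_iff decides_eq_overt_space[OF assms])
    have inter: "open_space X (index_prefix l (interleave p (interleave (pair_snd r) u))) = Some (U \<inter> B)"
      if u: "open_space X u = Some U" for u U
    proof (rule open_spaceI[OF l])
      fix q x assume x: "X q = Some x"
      show "(accepts (pair_snd (pair_snd (interleave p (interleave (pair_snd r) u)))) q \<and>
        accepts (pair_fst (pair_snd (interleave p (interleave (pair_snd r) u))))
         (index_prefix k (interleave (pair_fst (interleave p (interleave (pair_snd r) u))) q))) \<longleftrightarrow> x \<in> U \<inter> B"
        using open_space_accepts[OF u x] open_space_accepts[OF B(2) k[OF x]] k[OF x]
        by (auto simp: opens_meeting_def points_iff)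
    qed (use B in auto)
    have "open_space (open_space X) (index_prefix m (interleave p r)) = Some (opens_meeting X (A \<inter> B))"
    proof (rule open_spaceI[OF m opens_meeting_subset])
      fix u U assume u: "open_space X u = Some U"
      have "U \<inter> B \<inter> A = U \<inter> (A \<inter> B)" by blast
      then have "U \<inter> B \<in> opens_meeting X A \<longleftrightarrow> U \<in> opens_meeting X (A \<inter> B)"
        using u inter[OF u] unfolding opens_meeting_def by (auto simp: points_iff)
      then show "accepts (pair_fst (pair_snd (interleave p r)))
          (index_prefix l (interleave (pair_fst (interleave p r))
            (interleave (pair_snd (pair_snd (interleave p r))) u))) \<longleftrightarrow> U \<in> opens_meeting X (A \<inter> B)"
        using open_space_accepts[OF A(2) inter[OF u]] by simp
    qed
    then show ?thesis using A(1) by (auto simp: decides_eq_overt_space[OF assms])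
  qed
  then show ?thesis by (intro that) (auto simp: realizes_def)
qed

section \<open>Equality obtained from realizers\<close>

lemma yields_eq_singleton:
  assumes "realizes X (open_space X) F (\<lambda>x. {x})"
  shows "yields_eq X F pair_fst pair_snd"
  unfolding yields_eq_def
proof (intro allI impI)
  fix r x y assume r: "prod_space X X r = Some (x, y)"
  then obtain w where "F (pair_fst r) = Some w" "open_space X w = Some {x}"
    using assms unfolding realizes_def prod_space_eq_Some_iff by blast
  then show "\<exists>w. F (pair_fst r) = Some w \<and> (accepts w (pair_snd r) \<longleftrightarrow> x = y)"
    using r open_space_accepts[of X w "{x}" "pair_snd r" y] by (auto simp: prod_space_eq_Some_iff)
qed

text \<open>Oracle and input exchange roles: \<open>U\<close> meets \<open>{x}\<close> iff a name of
  \<open>U\<close>, now the input, accepts the oracle \<open>q\<close>. One index serves all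
  spaces.\<close>

lemma point_closure_name:
  "\<exists>m. \<forall>(X :: 'a rep_space) q x. X q = Some x \<longrightarrow>
    overt_space X (index_prefix m q) = Some (rep_topology X closure_of {x})"
proof -
  have "semidecidable (\<lambda>P Q. accepts Q P)"
    by (intro semidecidable_accepts decidable_sequences)
  then obtain m where m: "\<And>P Q. \<exists>r. otm_fun (nth_otm m) P Q = Some r \<and> (r \<noteq> zero_seq \<longleftrightarrow> accepts Q P)"
    by (rule semidecidable_otm) blast
  show ?thesis
  proof (intro exI allI impI)
    fix X :: "'a rep_space" and q x assume x: "X q = Some x"
    have "open_space (open_space X) (index_prefix m q) = Some (opens_meeting X {x})"
    proof (rule open_spaceI[OF m opens_meeting_subset])
      fix w U assume "open_space X w = Some U"
      then show "accepts w q \<longleftrightarrow> U \<in> opens_meeting X {x}"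
        using open_space_accepts[of X w U q x] x by (auto simp: opens_meeting_def points_iff)
    qed
    moreover have "{x} \<subseteq> points X" using x by (auto simp: points_iff)
    ultimately show "overt_space X (index_prefix m q) = Some (rep_topology X closure_of {x})"
      unfolding overt_space_eq_Some_iff by blast
  qed
qed

text \<open>Applied to a name of the closure of \<open>{x}\<close>, the realizer returns an open
  name of the same set. Acceptance of a name of \<open>y\<close> then says that \<open>y\<close>
  lies in this closure, which must be shown to mean \<open>x = y\<close>.\<close>

lemma yields_eq_id:
  fixes X :: "'a rep_space"
  assumes F: "realizes (overt_space X) (open_space X) F id" and t0: "t0_space (rep_topology X)"
  obtains m where "yields_eq X F (\<lambda>r. index_prefix m (pair_fst r)) pair_snd"
proof -
  let ?cl = "\<lambda>x. rep_topology X closure_of {x}"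
  obtain m where "\<forall>(X :: 'a rep_space) q x. X q = Some x \<longrightarrow>
      overt_space X (index_prefix m q) = Some (rep_topology X closure_of {x})"
    using point_closure_name ..
  then have m: "X q = Some x \<Longrightarrow> overt_space X (index_prefix m q) = Some (rep_topology X closure_of {x})" for q x
    by simp
  have name: "\<exists>w. F (index_prefix m q) = Some w \<and> open_space X w = Some (?cl x)" if "X q = Some x" for q x
    using m[OF that] F unfolding realizes_def by auto
  have open_cl: "openin (rep_topology X) (?cl x)" if "x \<in> points X" for x
    using name that unfolding points_open_space[symmetric] points_iff by blast
  have self: "x \<in> ?cl x" if "x \<in> points X" for x
    using that by (auto simp: in_closure_of topspace_rep_topology)
  \<comment> \<open>The closure of \<open>{y}\<close> is an open set around \<open>y\<close>, and
    every open set around \<open>y\<close> contains \<open>x\<close>.\<close>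
  have sym: "x \<in> ?cl y" if y: "y \<in> ?cl x" for x y
  proof -
    have "y \<in> points X" using y by (simp add: in_closure_of topspace_rep_topology)
    then show ?thesis
      using y open_cl self unfolding in_closure_of[of y] by blast
  qed
  have eq: "y \<in> ?cl x \<longleftrightarrow> x = y" if xy: "x \<in> points X" "y \<in> points X" for x y
  proof
    assume "y \<in> ?cl x"
    then have "\<And>U. openin (rep_topology X) U \<Longrightarrow> x \<in> U \<longleftrightarrow> y \<in> U"
      using sym[of y x] by (auto simp: in_closure_of)
    then show "x = y" using t0 xy unfolding t0_space_def topspace_rep_topology by blast
  qed (use self xy in auto)
  have "yields_eq X F (\<lambda>r. index_prefix m (pair_fst r)) pair_snd"
    unfolding yields_eq_def
  proof (intro allI impI)
    fix r x y assume "prod_space X X r = Some (x, y)"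
    then have r: "X (pair_fst r) = Some x" "X (pair_snd r) = Some y"
      by (auto simp: prod_space_eq_Some_iff)
    obtain w where w: "F (index_prefix m (pair_fst r)) = Some w" "open_space X w = Some (?cl x)"
      using name[OF r(1)] by blast
    then show "\<exists>w. F (index_prefix m (pair_fst r)) = Some w \<and> (accepts w (pair_snd r) \<longleftrightarrow> x = y)"
      using open_space_accepts[OF w(2) r(2)] eq r by (auto simp: points_iff)
  qed
  then show ?thesis by (rule that)
qed

text \<open>\<open>{x} \<inter> {y}\<close> is nonempty iff \<open>x = y\<close>, and an overt set
  is nonempty iff it meets the whole space. The constant second map is a name of
  \<open>points X\<close> for this test.\<close>

lemma yields_eq_inter:
  fixes X :: "'a rep_space"
  assumes F: "realizes (prod_space (overt_space X) (overt_space X)) (overt_space X) F (\<lambda>(A, B). A \<inter> B)"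
    and t1: "t1_space (rep_topology X)"
  obtains m e where "yields_eq X F
    (\<lambda>r. interleave (index_prefix m (pair_fst r)) (index_prefix m (pair_snd r))) (\<lambda>_. index_prefix e zero_seq)"
proof -
  obtain m where "\<forall>(X :: 'a rep_space) q x. X q = Some x \<longrightarrow>
      overt_space X (index_prefix m q) = Some (rep_topology X closure_of {x})"
    using point_closure_name ..
  then have cl: "X q = Some x \<Longrightarrow> overt_space X (index_prefix m q) = Some (rep_topology X closure_of {x})" for q x
    by simp
  have "rep_topology X closure_of {x} = {x}" if "X q = Some x" for q x
    using t1 that unfolding closure_of_eq t1_space_closedin_singleton topspace_rep_topology by (auto simp: points_iff)
  with cl have m: "\<And>q x. X q = Some x \<Longrightarrow> overt_space X (index_prefix m q) = Some {x}" by simp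
  have "semidecidable (\<lambda>_ _. True)"
    unfolding semidecidable_def using decidable_const[of True] by blast
  then obtain e where e: "\<And>P Q. \<exists>r. otm_fun (nth_otm e) P Q = Some r \<and> (r \<noteq> zero_seq \<longleftrightarrow> True)"
    by (rule semidecidable_otm) blast
  have e: "open_space X (index_prefix e zero_seq) = Some (points X)"
    by (rule open_spaceI[OF e]) (auto simp: points_iff)
  have "yields_eq X F (\<lambda>r. interleave (index_prefix m (pair_fst r)) (index_prefix m (pair_snd r)))
      (\<lambda>_. index_prefix e zero_seq)"
    unfolding yields_eq_def
  proof (intro allI impI)
    fix r x y assume r: "prod_space X X r = Some (x, y)"
    let ?r = "interleave (index_prefix m (pair_fst r)) (index_prefix m (pair_snd r))"
    have "prod_space (overt_space X) (overt_space X) ?r = Some ({x}, {y})"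
      using r m by (simp add: prod_space_eq_Some_iff)
    from F[unfolded realizes_def, rule_format, OF this]
    obtain w where w: "F ?r = Some w" "overt_space X w = Some ({x} \<inter> {y})"
      unfolding prod.case by blast
    \<comment> \<open>The name describes the opens meeting some \<open>A\<close> with this closure;
      that suffices, since a set is empty iff its closure is.\<close>
    then obtain A where A: "A \<subseteq> points X" "rep_topology X closure_of A = {x} \<inter> {y}"
      "open_space (open_space X) w = Some (opens_meeting X A)"
      unfolding overt_space_eq_Some_iff by blast
    have "accepts w (index_prefix e zero_seq) \<longleftrightarrow> points X \<in> opens_meeting X A"
      by (rule open_space_accepts[OF A(3) e])
    also have "\<dots> \<longleftrightarrow> A \<noteq> {}"
      using A(1) e by (auto simp: opens_meeting_def points_iff[of "points X"])
    also have "\<dots> \<longleftrightarrow> {x} \<inter> {y} \<noteq> {}"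
      unfolding A(2)[symmetric] using A(1) by (simp add: closure_of_eq_empty topspace_rep_topology)
    finally show "\<exists>w. F ?r = Some w \<and> (accepts w (index_prefix e zero_seq) \<longleftrightarrow> x = y)"
      using w(1) by auto
  qed
  then show ?thesis by (rule that)
qed

section \<open>The equivalences\<close>

text \<open>A computable name is the output of a machine on \<open>zero_seq\<close>, so reading
  equality off it is an instance of \<open>yields_eq\<close> with a constant first map.\<close>

lemma computable_diagonal_iff:
  "computable_point (open_space (prod_space X X)) (diagonal X) \<longleftrightarrow> (\<exists>n. decides_eq X n zero_seq)"
proof
  assume "computable_point (open_space (prod_space X X)) (diagonal X)"
  then obtain w n where w: "otm_fun (nth_otm n) zero_seq zero_seq = Some w"
    "open_space (prod_space X X) w = Some (diagonal X)"
    by (auto simp: computable_point_def computable_seq_def)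
  have "yields_eq X (otm_fun (nth_otm n) zero_seq) (\<lambda>_. zero_seq) (\<lambda>r. r)"
    unfolding yields_eq_def
  proof (intro allI impI)
    fix r x y assume r: "prod_space X X r = Some (x, y)"
    then have "accepts w r \<longleftrightarrow> x = y"
      using open_space_accepts[OF w(2) r] by (auto simp: diagonal_def prod_space_eq_Some_iff points_iff)
    then show "\<exists>w. otm_fun (nth_otm n) zero_seq zero_seq = Some w \<and> (accepts w r \<longleftrightarrow> x = y)"
      using w(1) by blast
  qed
  then show "\<exists>n. decides_eq X n zero_seq"
    by (rule yields_eq_computable) (auto simp: computable_fun_def intro: decidable_sequences)
next
  assume "\<exists>n. decides_eq X n zero_seq"
  then obtain n where "decides_eq X n zero_seq" by blast
  then have "open_space (prod_space X X) (index_prefix n zero_seq) = Some (diagonal X)"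
    unfolding open_space_diagonal_iff by blast
  moreover have "decidable (\<lambda>p q. index_prefix n zero_seq)" by (intro decidable_sequences)
  then have "computable_seq (index_prefix n zero_seq)"
    unfolding computable_seq_def by (metis decidable_otm)
  ultimately show "computable_point (open_space (prod_space X X)) (diagonal X)"
    unfolding computable_point_def by blast
qed

text \<open>\<open>K\<close> is a class of realizers, \<open>D\<close> says that equality is decided relative to the oracles allowed by \<open>K\<close>.\<close>

lemma realizer_iff_decides_eq:
  fixes X :: "'a rep_space"
  assumes "\<forall>F \<alpha> \<beta>. yields_eq X F \<alpha> \<beta> \<longrightarrow> K F \<longrightarrow>
      decidable (\<lambda>_. \<alpha>) \<longrightarrow> decidable (\<lambda>_. \<beta>) \<longrightarrow> D"
    and "D \<longrightarrow> (\<exists>n p. decides_eq X n p \<and> (\<forall>m. K (\<lambda>q. Some (index_prefix m (interleave p q)))))"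
  shows "(\<exists>F. K F \<and> realizes X (open_space X) F (\<lambda>x. {x})) \<longleftrightarrow> D" (is "?singleton \<longleftrightarrow> D")
    and "(\<exists>F. K F \<and> realizes (overt_space X) (open_space X) F id) \<and> t0_space (rep_topology X) \<longleftrightarrow> D"
      (is "?id \<longleftrightarrow> D")
    and "(\<exists>F. K F \<and> realizes (prod_space (overt_space X) (overt_space X)) (overt_space X) F (\<lambda>(A, B). A \<inter> B)) \<and>
      t1_space (rep_topology X) \<longleftrightarrow> D" (is "?inter \<longleftrightarrow> D")
proof -
  note to_eq = assms(1)[rule_format] and from_eq = assms(2)[rule_format]
  have D if a: "?singleton"
  proof -
    obtain F where F: "K F" "realizes X (open_space X) F (\<lambda>x. {x})" using a by blast
    show D
      by (rule to_eq[OF yields_eq_singleton[OF F(2)] F(1)]) (intro decidable_sequences)+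
  qed
  moreover have D if a: "?id"
  proof -
    obtain F where F: "K F" "realizes (overt_space X) (open_space X) F id"
      and sep: "t0_space (rep_topology X)" using a by blast
    obtain m where "yields_eq X F (\<lambda>r. index_prefix m (pair_fst r)) pair_snd"
      by (rule yields_eq_id[OF F(2) sep])
    then show D by (rule to_eq[OF _ F(1)]) (intro decidable_sequences)+
  qed
  moreover have D if a: "?inter"
  proof -
    obtain F where F: "K F"
        "realizes (prod_space (overt_space X) (overt_space X)) (overt_space X) F (\<lambda>(A, B). A \<inter> B)"
      and sep: "t1_space (rep_topology X)" using a by blast
    obtain m e where "yields_eq X F
        (\<lambda>r. interleave (index_prefix m (pair_fst r)) (index_prefix m (pair_snd r))) (\<lambda>_. index_prefix e zero_seq)"
      by (rule yields_eq_inter[OF F(2) sep])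
    then show D by (rule to_eq[OF _ F(1)]) (intro decidable_sequences)+
  qed
  moreover have "?singleton" "?id" "?inter" if a: D
  proof -
    obtain n p where d: "decides_eq X n p" and K: "\<And>m. K (\<lambda>q. Some (index_prefix m (interleave p q)))"
      using from_eq[OF a] by blast
    have sep: "t1_space (rep_topology X)" "t0_space (rep_topology X)"
      using decides_eq_t1[OF d] t1_imp_t0_space by auto
    show "?singleton" by (rule decides_eq_realizes_singleton[OF d]) (use K in blast)
    show "?id" by (rule decides_eq_realizes_id[OF d]) (use K sep in blast)
    show "?inter" by (rule decides_eq_realizes_inter[OF d]) (use K sep in blast)
  qed
  ultimately show "?singleton \<longleftrightarrow> D" "?id \<longleftrightarrow> D" "?inter \<longleftrightarrow> D" by blast+
qed

theorem theorem24:
  fixes X :: "'a rep_space"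
  shows
    "(rep_discrete X \<longleftrightarrow>
        rep_continuous (overt_space X) (open_space X) id \<and> t0_space (rep_topology X)) \<and>
     (rep_discrete X \<longleftrightarrow>
        rep_continuous (prod_space (overt_space X) (overt_space X)) (overt_space X) (\<lambda>(A, B). A \<inter> B) \<and>
        t1_space (rep_topology X)) \<and>
     (rep_discrete X \<longleftrightarrow> rep_continuous (prod_space X X) sierpinski (\<lambda>(x, y). x = y)) \<and>
     (rep_discrete X \<longleftrightarrow> diagonal X \<in> points (open_space (prod_space X X))) \<and>
     (rep_computably_discrete X \<longleftrightarrow>
        rep_computable (overt_space X) (open_space X) id \<and> t0_space (rep_topology X)) \<and>
     (rep_computably_discrete X \<longleftrightarrow>
        rep_computable (prod_space (overt_space X) (overt_space X)) (overt_space X) (\<lambda>(A, B). A \<inter> B) \<and>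
        t1_space (rep_topology X)) \<and>
     (rep_computably_discrete X \<longleftrightarrow> rep_computable (prod_space X X) sierpinski (\<lambda>(x, y). x = y)) \<and>
     (rep_computably_discrete X \<longleftrightarrow> computable_point (open_space (prod_space X X)) (diagonal X))"
proof -
  \<comment> \<open>Continuous instance: equality may be decided relative to any oracle.\<close>
  have "\<forall>F \<alpha> \<beta>. yields_eq X F \<alpha> \<beta> \<longrightarrow> continuous_fun F \<longrightarrow>
      decidable (\<lambda>_. \<alpha>) \<longrightarrow> decidable (\<lambda>_. \<beta>) \<longrightarrow> (\<exists>n p. decides_eq X n p)"
    and "(\<exists>n p. decides_eq X n p) \<longrightarrow> (\<exists>n p. decides_eq X n p \<and>
      (\<forall>m. continuous_fun (\<lambda>q. Some (index_prefix m (interleave p q)))))"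
    using yields_eq_continuous index_prefix_interleave(1) by blast+
  note cont = realizer_iff_decides_eq[OF this]
  \<comment> \<open>Computable instance: the oracle is \<open>zero_seq\<close>, for which the
    curried realizers are computable.\<close>
  have "\<forall>F \<alpha> \<beta>. yields_eq X F \<alpha> \<beta> \<longrightarrow> computable_fun F \<longrightarrow>
      decidable (\<lambda>_. \<alpha>) \<longrightarrow> decidable (\<lambda>_. \<beta>) \<longrightarrow> (\<exists>n. decides_eq X n zero_seq)"
    and "(\<exists>n. decides_eq X n zero_seq) \<longrightarrow> (\<exists>n p. decides_eq X n p \<and>
      (\<forall>m. computable_fun (\<lambda>q. Some (index_prefix m (interleave p q)))))"
    using yields_eq_computable index_prefix_interleave(2) by blast+
  note comp = realizer_iff_decides_eq[OF this]
  show ?thesis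
    unfolding rep_discrete_def rep_computably_discrete_def
      continuous_eq_iff diagonal_open_iff computable_eq_iff computable_diagonal_iff
    unfolding rep_continuous_iff rep_computable_iff cont comp by simp
qed

end
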